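(* Let $(X,Y,f)$ be either of the following two triples. (1) $X=Y=(0,1)$ with Lebesgue measure, and $f(x,y)=1$ if $x<y$, $f(x,y)=-1$ otherwise. (2) $X=Y=\mathbb{T}=\mathbb{R}/\mathbb{Z}$ (the circle of length $1$) with Lebesgue measure, and $f(x,y)=1$ if $\operatorname{dist}(x,y)<\tfrac14$, $f(x,y)=-1$ otherwise. Let $d\in\{1,2,3,\dots\}\cup\{\infty\}$, and let $E_d=\mathbb{R}^d$ with the Euclidean inner product if $d<\infty$, and $E_\infty$ an infinite-dimensional separable real Hilbert space. Then, in each of the two cases (1) and (2), the maximum of $$\iint_{X\times Y} f(x,y)\,\langle g(x),h(y)\rangle\,\mathrm{d}x\,\mathrm{d}y$$ over all measurable functions $g:X\to E_d$, $h:Y\to E_d$ satisfying $|g(x)|=1$ for all $x\in X$ and $|h(y)|=1$ for all $y\in Y$ is attained, and $$\max_{g,h}\iint_{X\times Y} f(x,y)\,\langle g(x),h(y)\rangle\,\mathrm{d}x\,\mathrm{d}y=\begin{cases}\dfrac12 & \text{if } d=1,\\[2mm] \dfrac{2}{\pi} & \text{if } 2\le d\le\infty.\end{cases}$$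
   Context: Here $\langle\cdot,\cdot\rangle$ denotes the inner product of $E_d$ and $|\cdot|$ the corresponding norm. For $d=1$ the functions $g,h$ take values in $\{-1,1\}$ and $\langle g(x),h(y)\rangle=g(x)h(y)$. On $\mathbb{T}=\mathbb{R}/\mathbb{Z}$, $\operatorname{dist}(x,y)$ is the arc-length distance, i.e. $\operatorname{dist}(x,y)=\min_{k\in\mathbb{Z}}|\tilde x-\tilde y-k|$ for any representatives $\tilde x,\tilde y\in\mathbb{R}$ of $x,y$ (so it takes values in $[0,\tfrac12]$), and Lebesgue measure on $\mathbb{T}$ has total mass $1$. *)

theory Defs
  imports "HOL-Analysis.Analysis"
begin

quotient_type circle = real / "\<lambda>x y :: real. x - y \<in> \<int>"
  morphisms rep_circle to_circle
proof (rule equivpI)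
  show "reflp (\<lambda>x y :: real. x - y \<in> \<int>)"
    by (simp add: reflp_def)
  show "symp (\<lambda>x y :: real. x - y \<in> \<int>)"
    by (metis (no_types, lifting) Ints_minus minus_diff_eq sympI)
  show "transp (\<lambda>x y :: real. x - y \<in> \<int>)"
  proof (rule transpI)
    fix x y z :: real
    assume "x - y \<in> \<int>" "y - z \<in> \<int>"
    then have "(x - y) + (y - z) \<in> \<int>" by (rule Ints_add)
    then show "x - z \<in> \<int>" by simp
  qed
qed

text \<open>Arc-length distance; the infimum is a minimum, see \<open>circle_dist_is_min\<close> below.\<close>

lift_definition circle_dist :: "circle \<Rightarrow> circle \<Rightarrow> real"
  is "\<lambda>x y. INF k::int. \<bar>x - y - of_int k\<bar>"
proof -
  fix x x' y y' :: real
  assume "x - x' \<in> \<int>" "y - y' \<in> \<int>"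
  then have "(x - x') - (y - y') \<in> \<int>" by (rule Ints_diff)
  then obtain m :: int where m: "(x - x') - (y - y') = of_int m" by (elim Ints_cases)
  have 1: "\<bar>x - y - of_int k\<bar> = \<bar>x' - y' - of_int (k - m)\<bar>" for k
    using m by simp
  have "range (\<lambda>k::int. \<bar>x - y - of_int k\<bar>) = (\<lambda>k. \<bar>x' - y' - of_int k\<bar>) ` range (\<lambda>k. k - m)"
    unfolding image_image by (simp only: 1)
  also have "range (\<lambda>k::int. k - m) = UNIV"
    by (metis add_diff_cancel_right' surjI)
  finally show "(INF k::int. \<bar>x - y - of_int k\<bar>) = (INF k::int. \<bar>x' - y' - of_int k\<bar>)"
    by simp
qed

lemma circle_dist_is_min:
  "\<exists>k::int. circle_dist (to_circle x) (to_circle y) = \<bar>x - y - of_int k\<bar> \<and>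
  (\<forall>j::int. \<bar>x - y - of_int k\<bar> \<le> \<bar>x - y - of_int j\<bar>)"
proof -
  have k: "\<bar>x - y - of_int (round (x-y))\<bar> \<le> \<bar>x - y - of_int j\<bar>" for j::int
    using round_diff_minimal[of "x-y" j] by simp
  have "(INF k::int. \<bar>x - y - of_int k\<bar>) = \<bar>x - y - of_int (round (x-y))\<bar>"
    using k by (intro cInf_eq_minimum) auto
  then show ?thesis using k by (auto simp: circle_dist.abs_eq)
qed

lemma bij_betw_to_circle: "bij_betw to_circle {0..<1} UNIV"
proof (rule bij_betwI')
  fix x y :: real assume "x \<in> {0..<1}" "y \<in> {0..<1}"
  then have "\<bar>x - y\<bar> < 1" by auto
  then have "x - y \<in> \<int> \<longleftrightarrow> x = y"
    using Ints_nonzero_abs_less1[of "x - y"] by auto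
  then show "to_circle x = to_circle y \<longleftrightarrow> x = y"
    by (simp add: circle.abs_eq_iff)
next
  fix c :: circle
  obtain x where c: "c = to_circle x" by (metis Quotient3_circle Quotient3_def)
  have "to_circle x = to_circle (frac x)"
    by (simp add: circle.abs_eq_iff frac_def)
  with c show "\<exists>x\<in>{0..<1}. c = to_circle x"
    by (intro bexI[of _ "frac x"]) (auto simp: frac_lt_1)
qed auto

text \<open>Lebesgue measure on the circle is carried over from the fundamental domain \<open>[0,1)\<close>,
  which the projection maps bijectively onto the circle (\<open>bij_betw_to_circle\<close>). Its measurable sets are the
  images of the Lebesgue measurable subsets of \<open>[0,1)\<close>.\<close>

definition circle_lebesgue :: "circle measure"
  where "circle_lebesgue = embed_measure (lebesgue_on {0..<1}) to_circle"

lemma space_circle_lebesgue: "space circle_lebesgue = UNIV"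
  using bij_betw_to_circle
  by (simp add: circle_lebesgue_def space_embed_measure space_restrict_space bij_betw_def)

lemma emeasure_circle_lebesgue: "emeasure circle_lebesgue UNIV = 1"
proof -
  have inj: "inj_on to_circle {0..<1}" and im: "to_circle ` {0..<1} = UNIV"
    using bij_betw_to_circle by (auto simp: bij_betw_def)
  have "to_circle ` {0..<1} \<in> sets circle_lebesgue"
    using sets.top[of circle_lebesgue] by (simp add: im space_circle_lebesgue)
  then have "emeasure circle_lebesgue (to_circle ` {0..<1}) =
      emeasure (lebesgue_on {0..<1}) (to_circle -` (to_circle ` {0..<1}) \<inter> space (lebesgue_on {0..<1}))"
    unfolding circle_lebesgue_def
    using inj by (intro emeasure_embed_measure') (auto simp: space_restrict_space)
  also have "to_circle -` (to_circle ` {0..<1}) \<inter> space (lebesgue_on {0..<1}) = {0..<1}"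
    by (auto simp: space_restrict_space)
  finally have "emeasure circle_lebesgue (to_circle ` {0..<1}) = emeasure (lebesgue_on {0..<1}) {0..<1::real}" .
  then show ?thesis by (simp add: im emeasure_restrict_space)
qed

definition order_kernel :: "real \<Rightarrow> real \<Rightarrow> real"
  where "order_kernel x y = (if x < y then 1 else -1)"

definition circle_kernel :: "circle \<Rightarrow> circle \<Rightarrow> real"
  where "circle_kernel x y = (if circle_dist x y < 1/4 then 1 else -1)"

definition sphere_maps :: "'x measure \<Rightarrow> ('x \<Rightarrow> 'e::real_inner) set"
  where "sphere_maps M = {g \<in> borel_measurable M. \<forall>x\<in>space M. norm (g x) = 1}"

definition kernel_integral ::
    "'x measure \<Rightarrow> 'y measure \<Rightarrow> ('x \<Rightarrow> 'y \<Rightarrow> real) \<Rightarrow> ('x \<Rightarrow> 'e::real_inner) \<Rightarrow> ('y \<Rightarrow> 'e) \<Rightarrow> real"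
  where "kernel_integral M N f g h = (\<integral>(x, y). f x y * inner (g x) (h y) \<partial>(M \<Otimes>\<^sub>M N))"

text \<open>The type argument selects the target space of the competing maps, whose values outside \<open>space M\<close> and \<open>space N\<close> are irrelevant.\<close>

definition is_max_kernel_integral ::
    "'e::real_inner itself \<Rightarrow> 'x measure \<Rightarrow> 'y measure \<Rightarrow> ('x \<Rightarrow> 'y \<Rightarrow> real) \<Rightarrow> real \<Rightarrow> bool"
  where "is_max_kernel_integral _ M N f c \<longleftrightarrow>
    (\<exists>(g :: 'x \<Rightarrow> 'e) \<in> sphere_maps M. \<exists>(h :: 'y \<Rightarrow> 'e) \<in> sphere_maps N.
        kernel_integral M N f g h = c) \<and>
    (\<forall>(g :: 'x \<Rightarrow> 'e) \<in> sphere_maps M. \<forall>(h :: 'y \<Rightarrow> 'e) \<in> sphere_maps N.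
        kernel_integral M N f g h \<le> c)"

definition infinite_dimensional :: "'a::real_vector itself \<Rightarrow> bool"
  where "infinite_dimensional _ \<longleftrightarrow> \<not> (\<exists>B :: 'a set. finite B \<and> span B = UNIV)"

end

theory Submission
  imports Defs
begin

text \<open>
  Both upper bounds come from one observation about the interval. For a scalar function \<open>v\<close> the
  transform \<open>F x = \<integral> order_kernel x y * v y \<partial>y\<close> is continuous with \<open>F 1 = - F 0\<close>, so it vanishes at some \<open>z\<close>
  (\<open>order_transform_has_zero\<close>). Adding or subtracting \<open>F z\<close> does not change \<open>F x\<close>, but it cancels the kernel
  except for those \<open>y\<close> that lie on the shorter arc from \<open>z\<close> to \<open>x\<close>, where the interval is regarded as a circle of
  length \<open>1\<close>; there the new kernel is at most \<open>2\<close> in absolute value (\<open>order_kernel_arc\<close>). Hence the double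
  integral is at most \<open>2 \<integral> \<integral> \<bar>u x\<bar> \<bar>v y\<bar>\<close> over pairs with \<open>y\<close> on the arc (\<open>kernel_integral_arc_bound\<close>).

  For \<open>\<bar>u\<bar>, \<bar>v\<bar> \<le> 1\<close> the arcs have mean length \<open>1/4\<close>, which gives \<open>1/2\<close> in dimension one (\<open>scalar_sup_bound\<close>).
  For square-integrable scalars a Schur test with cosine and sine weights shows that the arc kernel, and so the
  order kernel, has operator norm at most \<open>2/\<pi>\<close> (\<open>scalar_L2_bound\<close>, stated for bounded functions). An \<open>L\<^sup>2\<close> bound
  extends to Hilbert space coordinate by coordinate, first for maps into a finite-dimensional subspace and then by
  approximation with simple functions (\<open>span_L2_bound\<close>, \<open>sphere_bound\<close>).

  The circle reduces to the interval. If \<open>x\<close> runs over a half circle and \<open>y\<close> over a half circle shifted by a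
  quarter turn, the circle kernel becomes an order kernel, so the circle integral is the average of four
  interval integrals (\<open>kernel_integral_circle\<close>) and has the same upper bounds.

  The bounds are attained on the interval by a pair of maps that turn at constant speed through a half turn in a
  plane, a quarter turn apart, and in dimension one by \<open>1\<close> and the sign of \<open>1/2 - x\<close>. Both pairs
  extend to antiperiodic maps of the line, which is what makes them close up to maximizers on the circle
  (\<open>max_interval_and_circle\<close>).
\<close>

section \<open>Integrals over a period\<close>

abbreviation I01 :: "real measure" where "I01 \<equiv> lebesgue_on {0<..<1}"

lemma measurable_on_interval:
  fixes P :: "real \<Rightarrow> ennreal"
  assumes "P \<in> borel_measurable lebesgue"
  shows "(\<lambda>x. P x * indicator {a..<b} x) \<in> borel_measurable lebesgue"
  by (intro borel_measurable_times_ennreal borel_measurable_indicator assms) auto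

lemma nn_integral_lebesgue_shift:
  fixes Q :: "real \<Rightarrow> ennreal"
  assumes "Q \<in> borel_measurable lebesgue"
  shows "(\<integral>\<^sup>+x. Q x \<partial>lebesgue) = (\<integral>\<^sup>+x. Q (t + x) \<partial>lebesgue)"
  using nn_integral_real_affine_lebesgue[OF assms, of 1 t] by simp

lemma periodic_add_of_int:
  fixes P :: "real \<Rightarrow> 'a"
  assumes "\<And>x. P (x + 1) = P x"
  shows "P (x + of_int k) = P x"
proof (induction k arbitrary: x rule: int_induct[where k = 0])
  case (step1 i)
  then show ?case using assms[of "x + of_int i"] by (simp add: add.assoc)
next
  case (step2 i)
  then show ?case using assms[of "x + of_int (i - 1)"] by (simp add: algebra_simps)
qed simp

text \<open>Cut a period at the integer \<open>\<lceil>a\<rceil>\<close> it contains and move the right-hand piece one step back: the result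
  is a period between consecutive integers.\<close>

lemma nn_integral_period:
  fixes P :: "real \<Rightarrow> ennreal"
  assumes [measurable]: "P \<in> borel_measurable lebesgue" and per: "\<And>x. P (x + 1) = P x"
  shows "(\<integral>\<^sup>+x. P x * indicator {a..<a+1} x \<partial>lebesgue) = (\<integral>\<^sup>+x. P x * indicator {0..<1} x \<partial>lebesgue)"
proof -
  define n :: int where "n = \<lceil>a\<rceil>"
  have n: "a \<le> of_int n" "of_int n < a + 1" unfolding n_def by linarith+
  have "(\<integral>\<^sup>+x. P x * indicator {a..<a+1} x \<partial>lebesgue)
      = (\<integral>\<^sup>+x. P x * indicator {a..<of_int n} x + P x * indicator {of_int n..<a+1} x \<partial>lebesgue)"
    using n by (intro nn_integral_cong) (auto split: split_indicator)
  also have "\<dots> = (\<integral>\<^sup>+x. P x * indicator {a..<of_int n} x \<partial>lebesgue)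
      + (\<integral>\<^sup>+x. P x * indicator {of_int n..<a+1} x \<partial>lebesgue)"
    by (intro nn_integral_add measurable_on_interval assms)
  also have "(\<integral>\<^sup>+x. P x * indicator {of_int n..<a+1} x \<partial>lebesgue)
      = (\<integral>\<^sup>+x. P (1 + x) * indicator {of_int n..<a+1} (1 + x) \<partial>lebesgue)"
    by (intro nn_integral_lebesgue_shift measurable_on_interval assms)
  also have "\<dots> = (\<integral>\<^sup>+x. P x * indicator {of_int n - 1..<a} x \<partial>lebesgue)"
    using per by (intro nn_integral_cong) (auto split: split_indicator simp: add.commute)
  also have "(\<integral>\<^sup>+x. P x * indicator {a..<of_int n} x \<partial>lebesgue) + (\<integral>\<^sup>+x. P x * indicator {of_int n - 1..<a} x \<partial>lebesgue)
      = (\<integral>\<^sup>+x. P x * indicator {a..<of_int n} x + P x * indicator {of_int n - 1..<a} x \<partial>lebesgue)"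
    by (intro nn_integral_add[symmetric] measurable_on_interval assms)
  also have "\<dots> = (\<integral>\<^sup>+x. P x * indicator {of_int n - 1..<of_int n} x \<partial>lebesgue)"
    using n by (intro nn_integral_cong) (auto split: split_indicator)
  also have "\<dots> = (\<integral>\<^sup>+x. P (of_int (n-1) + x) * indicator {of_int n - 1..<of_int n} (of_int (n-1) + x) \<partial>lebesgue)"
    by (intro nn_integral_lebesgue_shift measurable_on_interval assms)
  also have "\<dots> = (\<integral>\<^sup>+x. P x * indicator {0..<1} x \<partial>lebesgue)"
  proof (rule nn_integral_cong)
    fix x
    have "P (of_int (n-1) + x) = P x"
      using periodic_add_of_int[of P x "n-1", OF per] by (simp only: add.commute)
    then show "P (of_int (n-1) + x) * indicator {of_int n - 1..<of_int n} (of_int (n-1) + x) = P x * indicator {0..<1} x"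
      by (auto split: split_indicator)
  qed
  finally show ?thesis .
qed

lemma nn_integral_I01:
  "(\<integral>\<^sup>+x. f x \<partial>I01) = (\<integral>\<^sup>+x. f x * indicator {0<..<1} x \<partial>lebesgue)"
  by (subst nn_integral_restrict_space) auto

lemma space_I01 [simp]: "space I01 = {0<..<1}"
  by (simp add: space_restrict_space)

lemma I01_borel_measurable:
  "f \<in> borel_measurable borel \<Longrightarrow> f \<in> borel_measurable I01"
  by (auto intro!: measurable_restrict_space1 measurable_completion)

lemma AE_lebesgue_neq: "AE x in lebesgue. x \<noteq> (c::real)"
  by (intro AE_completion AE_lborel_singleton)

lemma AE_I01_neq: "AE x in I01. x \<noteq> c"
  using AE_lebesgue_neq[of c] by (auto simp: AE_restrict_space_iff)

section \<open>Arcs and the order kernel\<close>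

text \<open>The representative of \<open>t\<close> modulo \<open>1\<close> in \<open>[-1/2, 1/2)\<close>.\<close>

definition centred :: "real \<Rightarrow> real" where
  "centred t = t - of_int \<lfloor>t + 1/2\<rfloor>"

lemma centred_bounds: "-1/2 \<le> centred t" "centred t < 1/2"
  unfolding centred_def by linarith+

lemma centred_eq: "-1/2 \<le> t - of_int k \<Longrightarrow> t - of_int k < 1/2 \<Longrightarrow> centred t = t - of_int k"
  unfolding centred_def by (simp add: floor_eq_iff)

lemma centred_measurable [measurable]: "centred \<in> borel_measurable borel"
  unfolding centred_def[abs_def] by measurable

text \<open>Rotation invariance of the circle \<open>\<real>/\<int>\<close>: in the coordinate \<open>centred (x - z)\<close> the point \<open>z\<close> of the
  interval becomes the origin.\<close>

lemma nn_integral_centred: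
  fixes \<phi> :: "real \<Rightarrow> ennreal"
  assumes [measurable]: "\<phi> \<in> borel_measurable borel"
  shows "(\<integral>\<^sup>+x. \<phi> (centred (x - z)) \<partial>I01) = (\<integral>\<^sup>+t. \<phi> t * indicator {-1/2..<1/2} t \<partial>lborel)"
proof -
  have m: "(\<lambda>x. \<phi> (centred (x - z))) \<in> borel_measurable lebesgue"
    by (rule measurable_completion) simp
  have "(\<integral>\<^sup>+x. \<phi> (centred (x - z)) \<partial>I01) = (\<integral>\<^sup>+x. \<phi> (centred (x - z)) * indicator {0..<1} x \<partial>lebesgue)"
    unfolding nn_integral_I01 using AE_lebesgue_neq[of 0]
    by (intro nn_integral_cong_AE) (auto split: split_indicator)
  also have "\<dots> = (\<integral>\<^sup>+x. \<phi> (centred (x - z)) * indicator {z-1/2..<z-1/2+1} x \<partial>lebesgue)"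
  proof (rule nn_integral_period[OF m, symmetric])
    fix x
    have "x + 1 - z + 1/2 = x - z + 1/2 + 1" by simp
    then have "\<lfloor>x + 1 - z + 1/2\<rfloor> = \<lfloor>x - z + 1/2\<rfloor> + 1" by (simp only: floor_add_int [symmetric]) linarith
    then show "\<phi> (centred (x + 1 - z)) = \<phi> (centred (x - z))" by (simp add: centred_def algebra_simps)
  qed
  also have "\<dots> = (\<integral>\<^sup>+x. \<phi> (centred (z + x - z)) * indicator {z-1/2..<z-1/2+1} (z + x) \<partial>lebesgue)"
    by (intro nn_integral_lebesgue_shift measurable_on_interval m)
  also have "\<dots> = (\<integral>\<^sup>+t. \<phi> t * indicator {-1/2..<1/2} t \<partial>lebesgue)"
    using centred_eq[of _ 0] by (intro nn_integral_cong) (auto split: split_indicator)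
  finally show ?thesis by (simp add: nn_integral_completion)
qed

text \<open>The shorter of the two arcs from \<open>z\<close> to \<open>x\<close> on the circle that arises from gluing \<open>0\<close> to \<open>1\<close>.\<close>

definition arc :: "real \<Rightarrow> real \<Rightarrow> real set" where
  "arc z x = {y. min 0 (centred (x - z)) \<le> centred (y - z) \<and> centred (y - z) \<le> max 0 (centred (x - z))}"

text \<open>The sign with which the kernel section at \<open>z\<close> is added to the one at \<open>x\<close>: \<open>-1\<close> if the shorter arc stays
  inside the interval, and \<open>1\<close> if it passes the gluing point, since the sections at \<open>0\<close> and \<open>1\<close> are opposite.\<close>

definition arc_sign :: "real \<Rightarrow> real \<Rightarrow> real" where
  "arc_sign z x = (if centred (x - z) = x - z then -1 else 1)"

lemma centred_cases:
  assumes "\<bar>t\<bar> \<le> 1"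
  obtains "centred t = t" "-1/2 \<le> t" "t < 1/2" | "centred t = t + 1" "t < -1/2" | "centred t = t - 1" "1/2 \<le> t"
proof -
  consider "t < -1/2" | "-1/2 \<le> t \<and> t < 1/2" | "1/2 \<le> t" by linarith
  then show ?thesis
  proof cases
    case 1
    then have "centred t = t + 1" using assms centred_eq[of t "-1"] by simp
    then show ?thesis using 1 that(2) by blast
  next
    case 2
    then have "centred t = t" using centred_eq[of t 0] by simp
    then show ?thesis using 2 that(1) by blast
  next
    case 3
    then have "centred t = t - 1" using assms centred_eq[of t 1] by simp
    then show ?thesis using 3 that(3) by blast
  qed
qed

text \<open>If the arc stays inside the interval, \<open>order_kernel x\<close> and \<open>order_kernel z\<close> agree for \<open>y\<close> off the arc.
  If it passes the gluing point, the points off the arc lie between \<open>x\<close> and \<open>z\<close>, where the two kernel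
  sections are opposite.\<close>

lemma order_kernel_arc:
  assumes "0 < x" "x < 1" "0 < y" "y < 1" "0 \<le> z" "z \<le> 1"
  shows "\<bar>order_kernel x y + arc_sign z x * order_kernel z y\<bar> \<le> 2 * indicator (arc z x) y"
proof -
  have eq0: "centred (y - z) = y - z" if "-1/2 \<le> y - z" "y - z < 1/2"
    using that centred_eq[of "y - z" 0] by simp
  have eq1: "centred (y - z) = y - z + 1" if "y - z < -1/2"
    using that assms centred_eq[of "y - z" "-1"] by simp
  have eq2: "centred (y - z) = y - z - 1" if "1/2 \<le> y - z"
    using that assms centred_eq[of "y - z" 1] by simp
  have near: "y \<in> arc z x" if ne: "order_kernel x y + arc_sign z x * order_kernel z y \<noteq> 0"
  proof -
    have "\<bar>x - z\<bar> \<le> 1" using assms by auto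
    then show ?thesis
    proof (cases rule: centred_cases)
      case 1
      have "x < y \<and> y \<le> z \<or> z < y \<and> y \<le> x"
        using ne 1(1) by (auto simp: order_kernel_def arc_sign_def split: if_splits)
      then show ?thesis using 1 eq0 by (auto simp: arc_def)
    next
      case 2
      have "x < y \<and> z < y \<or> y \<le> x \<and> y \<le> z"
        using ne 2(1) by (auto simp: order_kernel_def arc_sign_def split: if_splits)
      then show ?thesis using 2 eq0 eq1 assms by (auto simp: arc_def)
    next
      case 3
      have "x < y \<and> z < y \<or> y \<le> x \<and> y \<le> z"
        using ne 3(1) by (auto simp: order_kernel_def arc_sign_def split: if_splits)
      then show ?thesis using 3 eq0 eq2 assms by (auto simp: arc_def)
    qed
  qed
  have "\<bar>order_kernel x y + arc_sign z x * order_kernel z y\<bar> \<le> 2"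
    by (simp add: order_kernel_def arc_sign_def)
  with near show ?thesis
    by (cases "y \<in> arc z x") auto
qed

section \<open>The zero of the transform and the reduction to arcs\<close>

lemma finite_measure_I01: "finite_measure I01"
  by (rule finite_measure_lebesgue_on) simp

interpretation I01: finite_measure I01
  by (rule finite_measure_I01)

interpretation I01_pair: pair_sigma_finite I01 I01 ..

interpretation I01_prod: finite_measure "I01 \<Otimes>\<^sub>M I01"
  by (rule finite_measure_pair_measure) (rule finite_measure_I01)+

lemma ident_I01 [measurable]: "(\<lambda>x. x) \<in> borel_measurable I01"
  by (rule I01_borel_measurable) simp

lemma fst_I01 [measurable]: "fst \<in> borel_measurable (I01 \<Otimes>\<^sub>M M)"
  using measurable_compose[OF measurable_fst ident_I01] .

lemma snd_I01 [measurable]: "snd \<in> borel_measurable (M \<Otimes>\<^sub>M I01)"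
  using measurable_compose[OF measurable_snd ident_I01] .

lemma order_kernel_measurable [measurable (raw)]:
  assumes [measurable]: "f \<in> borel_measurable M" "g \<in> borel_measurable M"
  shows "(\<lambda>p. order_kernel (f p) (g p)) \<in> borel_measurable M"
  unfolding order_kernel_def by measurable

lemma arc_measurable [measurable (raw)]:
  assumes [measurable]: "f \<in> borel_measurable M" "g \<in> borel_measurable M"
  shows "(\<lambda>p. indicator (arc z (f p)) (g p) :: real) \<in> borel_measurable M"
  unfolding arc_def indicator_def by measurable

lemma arc_sign_measurable [measurable (raw)]:
  assumes [measurable]: "f \<in> borel_measurable M"
  shows "(\<lambda>p. arc_sign z (f p)) \<in> borel_measurable M"
  unfolding arc_sign_def by measurable

lemma abs_order_kernel [simp]: "\<bar>order_kernel x y\<bar> = 1"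
  by (simp add: order_kernel_def)

lemma abs_arc_sign [simp]: "\<bar>arc_sign z x\<bar> = 1"
  by (simp add: arc_sign_def)

lemma space_I01_prod [simp]: "space (I01 \<Otimes>\<^sub>M I01) = {0<..<1} \<times> {0<..<1}"
  by (simp add: space_pair_measure)

lemma integrable_I01_bounded:
  fixes f :: "real \<Rightarrow> real"
  assumes "f \<in> borel_measurable I01" "\<And>x. 0 < x \<Longrightarrow> x < 1 \<Longrightarrow> \<bar>f x\<bar> \<le> B"
  shows "integrable I01 f"
  using assms by (intro I01.integrable_const_bound[of _ B] AE_I2) auto

lemma integrable_I01_prod_bounded:
  fixes f :: "real \<times> real \<Rightarrow> real"
  assumes "f \<in> borel_measurable (I01 \<Otimes>\<^sub>M I01)"
    and "\<And>x y. 0 < x \<Longrightarrow> x < 1 \<Longrightarrow> 0 < y \<Longrightarrow> y < 1 \<Longrightarrow> \<bar>f (x, y)\<bar> \<le> B"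
  shows "integrable (I01 \<Otimes>\<^sub>M I01) f"
  using assms by (intro I01_prod.integrable_const_bound[of _ B] AE_I2) auto

lemma measure_I01: "measure I01 {0<..<1} = 1"
  by (simp add: measure_restrict_space)

text \<open>The transform of \<open>v\<close> is \<open>\<integral> v\<close> at \<open>0\<close> and \<open>- \<integral> v\<close> at \<open>1\<close>, and it is Lipschitz in between, so the
  intermediate value theorem applies.\<close>

lemma order_transform_has_zero:
  fixes v :: "real \<Rightarrow> real"
  assumes v [measurable]: "v \<in> borel_measurable I01" and B: "\<And>x. 0 < x \<Longrightarrow> x < 1 \<Longrightarrow> \<bar>v x\<bar> \<le> B"
  shows "\<exists>z. 0 \<le> z \<and> z \<le> 1 \<and> (\<integral>y. order_kernel z y * v y \<partial>I01) = 0"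
proof -
  define F where "F t = (\<integral>y. order_kernel t y * v y \<partial>I01)" for t
  have B0: "B \<ge> 0" using B[of "1/2"] by auto
  have int: "integrable I01 (\<lambda>y. order_kernel t y * v y)" for t
    by (rule integrable_I01_bounded[of _ B]) (auto simp: abs_mult B)
  have lip: "\<bar>F s - F t\<bar> \<le> 2 * B * \<bar>s - t\<bar>" for s t
  proof -
    \<comment> \<open>The sections at \<open>s\<close> and \<open>t\<close> differ only for \<open>y\<close> between \<open>s\<close> and \<open>t\<close>.\<close>
    have i: "integrable I01 (\<lambda>y. 2 * B * indicator {min s t..max s t} y)"
      using B0 by (intro integrable_I01_bounded[of _ "2 * B"] I01_borel_measurable) (auto simp: indicator_def)
    have "F s - F t = (\<integral>y. order_kernel s y * v y - order_kernel t y * v y \<partial>I01)"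
      unfolding F_def by (rule Bochner_Integration.integral_diff[symmetric]) (rule int)+
    also have "\<bar>\<dots>\<bar> \<le> (\<integral>y. 2 * B * indicator {min s t..max s t} y \<partial>I01)"
      unfolding real_norm_def[symmetric]
    proof (rule Bochner_Integration.integral_norm_bound_integral[OF _ i])
      show "integrable I01 (\<lambda>y. order_kernel s y * v y - order_kernel t y * v y)"
        using int by (intro Bochner_Integration.integrable_diff)
      fix y assume "y \<in> space I01"
      then have "\<bar>v y\<bar> \<le> B" by (auto intro: B)
      then show "norm (order_kernel s y * v y - order_kernel t y * v y) \<le> 2 * B * indicator {min s t..max s t} y"
        by (auto simp: order_kernel_def indicator_def)
    qed
    also have "\<dots> = 2 * B * measure I01 ({min s t..max s t} \<inter> {0<..<1})"
      by (simp add: Bochner_Integration.integral_indicator)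
    also have "measure I01 ({min s t..max s t} \<inter> {0<..<1}) = measure lebesgue ({min s t..max s t} \<inter> {0<..<1})"
      by (rule measure_restrict_space) auto
    also have "\<dots> \<le> measure lebesgue {min s t..max s t}"
      by (rule measure_mono_fmeasurable) auto
    also have "measure lebesgue {min s t..max s t} = \<bar>s - t\<bar>" by (auto simp: abs_if)
    finally show ?thesis using B0 by (simp add: mult_left_mono)
  qed
  have "continuous_on {0..1} F"
    by (rule lipschitz_on_continuous_on[of "2 * B"]) (use lip B0 in \<open>auto simp: lipschitz_on_def dist_real_def\<close>)
  moreover have "F 1 = - F 0"
  proof -
    have "F 1 = (\<integral>y. - (order_kernel 0 y * v y) \<partial>I01)"
      unfolding F_def by (rule Bochner_Integration.integral_cong) (auto simp: order_kernel_def)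
    then show ?thesis by (simp add: F_def)
  qed
  ultimately show ?thesis
    using IVT'[of F 0 0 1] IVT2'[of F 1 0 0] unfolding F_def[symmetric]
    by (cases "F 0 \<le> 0") auto
qed

text \<open>Since \<open>\<integral> order_kernel z y * v y \<partial>y\<close> vanishes, any multiple of that kernel section, with a
  factor depending only on \<open>x\<close>, may be added without changing the double integral. The factor
  \<open>arc_sign z x\<close> cancels all of \<open>order_kernel x\<close> off the arc.\<close>

lemma kernel_integral_arc_bound:
  fixes u v :: "real \<Rightarrow> real"
  assumes u [measurable]: "u \<in> borel_measurable I01" and v [measurable]: "v \<in> borel_measurable I01"
    and Bu: "\<And>x. 0 < x \<Longrightarrow> x < 1 \<Longrightarrow> \<bar>u x\<bar> \<le> B" and Bv: "\<And>x. 0 < x \<Longrightarrow> x < 1 \<Longrightarrow> \<bar>v x\<bar> \<le> B"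
  obtains z where "0 \<le> z" "z \<le> 1"
    "ennreal \<bar>kernel_integral I01 I01 order_kernel u v\<bar>
      \<le> (\<integral>\<^sup>+x. \<integral>\<^sup>+y. ennreal (indicator (arc z x) y * (2 * \<bar>u x\<bar> * \<bar>v y\<bar>)) \<partial>I01 \<partial>I01)"
proof -
  obtain z where z: "0 \<le> z" "z \<le> 1" and z0: "(\<integral>y. order_kernel z y * v y \<partial>I01) = 0"
    using order_transform_has_zero[OF v Bv] by blast
  have B0: "B \<ge> 0" using Bu[of "1/2"] by auto
  define w1 where "w1 = (\<lambda>(x, y). order_kernel x y * (u x * v y))"
  define w2 where "w2 = (\<lambda>(x, y). (arc_sign z x * u x) * (order_kernel z y * v y))"
  have i1: "integrable (I01 \<Otimes>\<^sub>M I01) w1"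
    unfolding w1_def using B0
    by (intro integrable_I01_prod_bounded[of _ "B * B"]) (auto simp: abs_mult split_beta intro!: mult_mono Bu Bv)
  have i2: "integrable (I01 \<Otimes>\<^sub>M I01) w2"
    unfolding w2_def using B0
    by (intro integrable_I01_prod_bounded[of _ "B * B"]) (auto simp: abs_mult split_beta intro!: mult_mono Bu Bv)
  have "integral\<^sup>L (I01 \<Otimes>\<^sub>M I01) w2 = (\<integral>x. (\<integral>y. w2 (x, y) \<partial>I01) \<partial>I01)"
    by (rule I01_pair.integral_fst'[OF i2, symmetric])
  also have "\<dots> = 0" by (simp add: w2_def z0)
  finally have "kernel_integral I01 I01 order_kernel u v = integral\<^sup>L (I01 \<Otimes>\<^sub>M I01) (\<lambda>p. w1 p + w2 p)"
    using i1 i2 by (simp add: kernel_integral_def w1_def inner_real_def)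
  then have "ennreal \<bar>kernel_integral I01 I01 order_kernel u v\<bar> \<le> (\<integral>\<^sup>+p. ennreal (norm (w1 p + w2 p)) \<partial>(I01 \<Otimes>\<^sub>M I01))"
    using integral_norm_bound_ennreal[of "I01 \<Otimes>\<^sub>M I01" "\<lambda>p. w1 p + w2 p"] i1 i2 by simp
  also have "\<dots> = (\<integral>\<^sup>+x. \<integral>\<^sup>+y. ennreal (norm (w1 (x, y) + w2 (x, y))) \<partial>I01 \<partial>I01)"
    using i1 i2 by (intro I01.nn_integral_fst[symmetric]) auto
  also have "\<dots> \<le> (\<integral>\<^sup>+x. \<integral>\<^sup>+y. ennreal (indicator (arc z x) y * (2 * \<bar>u x\<bar> * \<bar>v y\<bar>)) \<partial>I01 \<partial>I01)"
  proof (intro nn_integral_mono ennreal_leI)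
    fix x y assume "x \<in> space I01" "y \<in> space I01"
    then have "\<bar>order_kernel x y + arc_sign z x * order_kernel z y\<bar> * \<bar>u x * v y\<bar> \<le> 2 * indicator (arc z x) y * \<bar>u x * v y\<bar>"
      using z by (intro mult_right_mono order_kernel_arc) auto
    moreover have "w1 (x, y) + w2 (x, y) = (order_kernel x y + arc_sign z x * order_kernel z y) * (u x * v y)"
      by (simp add: w1_def w2_def algebra_simps)
    ultimately show "norm (w1 (x, y) + w2 (x, y)) \<le> indicator (arc z x) y * (2 * \<bar>u x\<bar> * \<bar>v y\<bar>)"
      by (simp add: abs_mult mult_ac)
  qed
  finally show ?thesis using z that by blast
qed

section \<open>The bounds for scalar functions\<close>

lemma cos_pi_nonneg:
  assumes "\<bar>t\<bar> \<le> 1/2" shows "0 \<le> cos (pi * t)"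
proof (rule cos_ge_zero)
  have "pi * t \<le> pi * (1/2)" "pi * (- (1/2)) \<le> pi * t"
    using assms by (intro mult_left_mono; simp)+
  then show "pi * t \<le> pi / 2" "- (pi / 2) \<le> pi * t" by simp_all
qed

lemma cos_pi_pos:
  assumes "\<bar>t\<bar> < 1/2" shows "0 < cos (pi * t)"
proof (rule cos_gt_zero_pi)
  have "pi * t < pi * (1/2)" "pi * (- (1/2)) < pi * t"
    using assms by (intro mult_strict_left_mono; simp)+
  then show "pi * t < pi / 2" "- (pi / 2) < pi * t" by simp_all
qed

text \<open>Integrals over the arc in its two variables. With \<open>s = centred (x - z)\<close> and \<open>t = centred (y - z)\<close> the
  kernel \<open>y \<in> arc z x\<close> maps the weight \<open>cos (\<pi> t)\<close> to a multiple \<open>1 / \<pi>\<close> of \<open>sin (\<pi> \<bar>s\<bar>)\<close>, and its transpose maps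
  \<open>sin (\<pi> \<bar>s\<bar>)\<close> back to at most the same multiple of \<open>cos (\<pi> t)\<close>. These weights are what the Schur test
  in \<open>scalar_L2_bound\<close> uses.\<close>

lemma nn_integral_cos_arc:
  assumes s: "centred (x - z) = s"
  shows "(\<integral>\<^sup>+y. ennreal (indicator (arc z x) y * cos (pi * centred (y - z))) \<partial>I01) = ennreal (sin (pi * \<bar>s\<bar>) / pi)"
proof -
  have sb: "-1/2 \<le> s" "s < 1/2" using centred_bounds[of "x - z"] s by auto
  have "(\<integral>\<^sup>+y. ennreal (indicator (arc z x) y * cos (pi * centred (y - z))) \<partial>I01)
      = (\<integral>\<^sup>+y. ennreal (indicator {min 0 s..max 0 s} (centred (y - z)) * cos (pi * centred (y - z))) \<partial>I01)"
    by (intro nn_integral_cong) (auto simp: arc_def s indicator_def)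
  also have "\<dots> = (\<integral>\<^sup>+t. ennreal (indicator {min 0 s..max 0 s} t * cos (pi * t)) * indicator {-1/2..<1/2} t \<partial>lborel)"
    by (rule nn_integral_centred) measurable
  also have "\<dots> = (\<integral>\<^sup>+t. ennreal (cos (pi * t)) * indicator {min 0 s..max 0 s} t \<partial>lborel)"
    using sb by (intro nn_integral_cong) (auto split: split_indicator)
  also have "\<dots> = ennreal (sin (pi * max 0 s) / pi - sin (pi * min 0 s) / pi)"
  proof (rule nn_integral_FTC_Icc)
    fix t assume t: "t \<in> {min 0 s..max 0 s}"
    show "((\<lambda>t. sin (pi * t) / pi) has_real_derivative cos (pi * t)) (at t)"
      by (auto intro!: derivative_eq_intros)
    have "\<bar>t\<bar> \<le> 1/2" using t sb by auto
    then show "0 \<le> cos (pi * t)" by (rule cos_pi_nonneg)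
  qed auto
  also have "sin (pi * max 0 s) / pi - sin (pi * min 0 s) / pi = sin (pi * \<bar>s\<bar>) / pi"
    by (auto simp: min_def max_def)
  finally show ?thesis .
qed

lemma nn_integral_sin_arc:
  assumes t: "centred (y - z) = t" and t0: "t \<noteq> 0"
  shows "(\<integral>\<^sup>+x. ennreal (indicator (arc z x) y * sin (pi * \<bar>centred (x - z)\<bar>)) \<partial>I01) \<le> ennreal (cos (pi * t) / pi)"
proof -
  have tb: "-1/2 \<le> t" "t < 1/2" using centred_bounds[of "y - z"] t by auto
  \<comment> \<open>For fixed \<open>t \<noteq> 0\<close> the arc from \<open>0\<close> to \<open>s\<close> contains \<open>t\<close> iff \<open>s\<close> is on the same side as
    \<open>t\<close> and not closer to \<open>0\<close>.\<close>
  define a b :: real where "a = (if t > 0 then t else -1/2)" and "b = (if t > 0 then 1/2 else t)"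
  have "(\<integral>\<^sup>+x. ennreal (indicator (arc z x) y * sin (pi * \<bar>centred (x - z)\<bar>)) \<partial>I01)
      = (\<integral>\<^sup>+x. ennreal (indicator {s. min 0 s \<le> t \<and> t \<le> max 0 s} (centred (x - z)) * sin (pi * \<bar>centred (x - z)\<bar>)) \<partial>I01)"
    by (intro nn_integral_cong) (auto simp: arc_def t indicator_def)
  also have "\<dots> = (\<integral>\<^sup>+s. ennreal (indicator {s. min 0 s \<le> t \<and> t \<le> max 0 s} s * sin (pi * \<bar>s\<bar>)) * indicator {-1/2..<1/2} s \<partial>lborel)"
    by (rule nn_integral_centred) measurable
  also have "\<dots> \<le> (\<integral>\<^sup>+s. ennreal (sgn t * sin (pi * s)) * indicator {a..b} s \<partial>lborel)"
    using t0 tb by (intro nn_integral_mono) (auto simp: a_def b_def split: split_indicator)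
  also have "\<dots> = ennreal (- sgn t * cos (pi * b) / pi - (- sgn t * cos (pi * a) / pi))"
  proof (rule nn_integral_FTC_Icc)
    fix s assume s: "s \<in> {a..b}"
    show "((\<lambda>s. - sgn t * cos (pi * s) / pi) has_real_derivative sgn t * sin (pi * s)) (at s)"
      by (auto intro!: derivative_eq_intros)
    have "0 \<le> sgn t * s" "sgn t * s \<le> 1"
      using s tb t0 by (auto simp: a_def b_def sgn_if split: if_splits)
    then have "0 \<le> sin (pi * (sgn t * s))" by (intro sin_ge_zero) (auto simp: mult_left_le)
    then show "0 \<le> sgn t * sin (pi * s)" by (auto simp: sgn_if split: if_splits)
  qed (use tb t0 in \<open>auto simp: a_def b_def\<close>)
  also have "- sgn t * cos (pi * b) / pi - (- sgn t * cos (pi * a) / pi) = cos (pi * t) / pi"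
    using t0 by (auto simp: a_def b_def sgn_if)
  finally show ?thesis .
qed

text \<open>The arc from \<open>z\<close> to \<open>x\<close> has length at most the distance from \<open>z\<close> to \<open>x\<close>, whose mean over the circle is \<open>1/4\<close>.\<close>

lemma nn_integral_arc:
  "(\<integral>\<^sup>+x. \<integral>\<^sup>+y. ennreal (indicator (arc z x) y) \<partial>I01 \<partial>I01) \<le> ennreal (1/4)"
proof -
  (* The measurability goals below concern Borel functions on the real line. *)
  note ident_I01[measurable del]
  have "(\<integral>\<^sup>+y. ennreal (indicator (arc z x) y) \<partial>I01) \<le> ennreal \<bar>centred (x - z)\<bar>" for x
  proof -
    define s where "s = centred (x - z)"
    have "(\<integral>\<^sup>+y. ennreal (indicator (arc z x) y) \<partial>I01)
        = (\<integral>\<^sup>+y. ennreal (indicator {min 0 s..max 0 s} (centred (y - z))) \<partial>I01)"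
      by (intro nn_integral_cong) (auto simp: arc_def s_def indicator_def)
    also have "\<dots> = (\<integral>\<^sup>+t. ennreal (indicator {min 0 s..max 0 s} t) * indicator {-1/2..<1/2} t \<partial>lborel)"
      by (rule nn_integral_centred) measurable
    also have "\<dots> \<le> (\<integral>\<^sup>+t. indicator {min 0 s..max 0 s} t \<partial>lborel)"
      by (intro nn_integral_mono) (auto split: split_indicator)
    also have "\<dots> = ennreal \<bar>s\<bar>"
      by (auto simp: min_def max_def)
    finally show ?thesis by (simp add: s_def)
  qed
  then have "(\<integral>\<^sup>+x. \<integral>\<^sup>+y. ennreal (indicator (arc z x) y) \<partial>I01 \<partial>I01) \<le> (\<integral>\<^sup>+x. ennreal \<bar>centred (x - z)\<bar> \<partial>I01)"
    by (intro nn_integral_mono)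
  also have "\<dots> = (\<integral>\<^sup>+s. ennreal \<bar>s\<bar> * indicator {-1/2..<1/2} s \<partial>lborel)"
    by (rule nn_integral_centred) measurable
  also have "\<dots> \<le> (\<integral>\<^sup>+s. ennreal (- s) * indicator {-1/2..0} s + ennreal s * indicator {0..1/2} s \<partial>lborel)"
    by (intro nn_integral_mono) (auto split: split_indicator simp: abs_if)
  also have "\<dots> = (\<integral>\<^sup>+s. ennreal (- s) * indicator {-1/2..0} s \<partial>lborel) + (\<integral>\<^sup>+s. ennreal s * indicator {0..1/2} s \<partial>lborel)"
    by (rule nn_integral_add) measurable
  also have "(\<integral>\<^sup>+s. ennreal (- s) * indicator {-1/2..0} s \<partial>lborel) = ennreal (- ((0::real)^2/2) - (-((-1/2)^2/2)))"
    by (rule nn_integral_FTC_Icc)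
       (auto intro!: derivative_eq_intros)
  also have "(\<integral>\<^sup>+s. ennreal s * indicator {0..1/2} s \<partial>lborel) = ennreal ((1/2)^2/2 - 0^2/2)"
    by (rule nn_integral_FTC_Icc)
       (auto intro!: derivative_eq_intros)
  finally show ?thesis by (simp add: power2_eq_square ennreal_plus[symmetric] del: ennreal_plus)
qed

lemma weighted_am_gm:
  fixes a b c s :: real
  assumes "c > 0" "s > 0"
  shows "2 * a * b \<le> a\<^sup>2 * (c / s) + b\<^sup>2 * (s / c)"
proof -
  have "0 \<le> (a * c - b * s)\<^sup>2 / (c * s)" using assms by simp
  also have "\<dots> = a\<^sup>2 * (c / s) + b\<^sup>2 * (s / c) - 2 * a * b"
    using assms by (simp add: power2_eq_square field_simps)
  finally show ?thesis by simp
qed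

text \<open>The one-dimensional bound: the reduced kernel is at most \<open>2\<close> on a set of measure at most \<open>1/4\<close>.\<close>

lemma scalar_sup_bound:
  fixes u v :: "real \<Rightarrow> real"
  assumes "u \<in> borel_measurable I01" "v \<in> borel_measurable I01"
    and Bu: "\<And>x. 0 < x \<Longrightarrow> x < 1 \<Longrightarrow> \<bar>u x\<bar> \<le> 1" and Bv: "\<And>x. 0 < x \<Longrightarrow> x < 1 \<Longrightarrow> \<bar>v x\<bar> \<le> 1"
  shows "\<bar>kernel_integral I01 I01 order_kernel u v\<bar> \<le> 1/2"
proof -
  obtain z where "ennreal \<bar>kernel_integral I01 I01 order_kernel u v\<bar>
      \<le> (\<integral>\<^sup>+x. \<integral>\<^sup>+y. ennreal (indicator (arc z x) y * (2 * \<bar>u x\<bar> * \<bar>v y\<bar>)) \<partial>I01 \<partial>I01)"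
    using kernel_integral_arc_bound[OF assms] by blast
  also have "\<dots> \<le> (\<integral>\<^sup>+x. \<integral>\<^sup>+y. 2 * ennreal (indicator (arc z x) y) \<partial>I01 \<partial>I01)"
  proof (intro nn_integral_mono)
    fix x y assume "x \<in> space I01" "y \<in> space I01"
    then have "\<bar>u x\<bar> * \<bar>v y\<bar> \<le> 1" using Bu[of x] Bv[of y] by (intro mult_le_one) auto
    then have "ennreal (indicator (arc z x) y * (2 * \<bar>u x\<bar> * \<bar>v y\<bar>)) \<le> ennreal (2 * indicator (arc z x) y)"
      by (intro ennreal_leI) (auto split: split_indicator)
    then show "ennreal (indicator (arc z x) y * (2 * \<bar>u x\<bar> * \<bar>v y\<bar>)) \<le> 2 * ennreal (indicator (arc z x) y)"
      by (simp add: ennreal_mult'')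
  qed
  also have "\<dots> = 2 * (\<integral>\<^sup>+x. \<integral>\<^sup>+y. ennreal (indicator (arc z x) y) \<partial>I01 \<partial>I01)"
    by (simp add: nn_integral_cmult)
  also have "\<dots> \<le> 2 * ennreal (1/4)"
    by (intro mult_left_mono nn_integral_arc) auto
  also have "\<dots> = ennreal (1/2)"
    by (subst ennreal_numeral[symmetric], subst ennreal_mult[symmetric]) auto
  finally have "ennreal \<bar>kernel_integral I01 I01 order_kernel u v\<bar> \<le> ennreal (1/2)" .
  then show ?thesis by (subst (asm) ennreal_le_iff) auto
qed

text \<open>A Schur test for the kernel \<open>2 * indicator (arc z x) y\<close>: split the product \<open>2 \<bar>u x\<bar> \<bar>v y\<bar>\<close> by
  the weighted arithmetic-geometric mean inequality with weight \<open>cos (\<pi> t) / sin (\<pi> \<bar>s\<bar>)\<close>, so that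
  \<open>nn_integral_cos_arc\<close> and \<open>nn_integral_sin_arc\<close> integrate out the variable that the function in each
  summand does not depend on. The constant \<open>1/\<pi>\<close> on each side corresponds to the operator norm \<open>2/\<pi>\<close>.\<close>

lemma scalar_L2_bound:
  fixes u v :: "real \<Rightarrow> real"
  assumes u [measurable]: "u \<in> borel_measurable I01" and v [measurable]: "v \<in> borel_measurable I01"
    and Bu: "\<And>x. 0 < x \<Longrightarrow> x < 1 \<Longrightarrow> \<bar>u x\<bar> \<le> B" and Bv: "\<And>x. 0 < x \<Longrightarrow> x < 1 \<Longrightarrow> \<bar>v x\<bar> \<le> B"
  shows "\<bar>kernel_integral I01 I01 order_kernel u v\<bar> \<le> ((\<integral>x. (u x)\<^sup>2 \<partial>I01) + (\<integral>y. (v y)\<^sup>2 \<partial>I01)) / pi"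
proof -
  obtain z where z: "ennreal \<bar>kernel_integral I01 I01 order_kernel u v\<bar>
      \<le> (\<integral>\<^sup>+x. \<integral>\<^sup>+y. ennreal (indicator (arc z x) y * (2 * \<bar>u x\<bar> * \<bar>v y\<bar>)) \<partial>I01 \<partial>I01)" and z01: "0 \<le> z" "z \<le> 1"
    using kernel_integral_arc_bound[OF assms] by blast
  define S C where "S x = sin (pi * \<bar>centred (x - z)\<bar>)" and "C y = cos (pi * centred (y - z))" for x y
  have [measurable]: "S \<in> borel_measurable I01" "C \<in> borel_measurable I01"
    unfolding S_def[abs_def] C_def[abs_def] by measurable
  define P where "P x y = indicator (arc z x) y * ((u x)\<^sup>2 * (C y / S x))" for x y
  define Q where "Q x y = indicator (arc z x) y * ((v y)\<^sup>2 * (S x / C y))" for x y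
  have [measurable]: "(\<lambda>(x, y). ennreal (P x y)) \<in> borel_measurable (I01 \<Otimes>\<^sub>M I01)"
    "(\<lambda>(x, y). ennreal (Q x y)) \<in> borel_measurable (I01 \<Otimes>\<^sub>M I01)"
    unfolding P_def[abs_def] Q_def[abs_def] by measurable
  have Pm: "(\<lambda>y. ennreal (P x y)) \<in> borel_measurable I01" if "x \<in> space I01" for x
    unfolding P_def[abs_def] by measurable
  have Qm: "(\<lambda>y. ennreal (Q x y)) \<in> borel_measurable I01" if "x \<in> space I01" for x
    unfolding Q_def[abs_def] by measurable
  \<comment> \<open>The sine weight vanishes at \<open>z\<close> and the cosine weight opposite to \<open>z\<close>, so these points are excluded.\<close>
  have nz: "AE x in I01. centred (x - z) \<noteq> 0"
    using AE_I01_neq[of z] AE_space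
  proof eventually_elim
    case (elim x)
    then have "\<bar>x - z\<bar> \<le> 1" using z01 by auto
    then show ?case using elim z01 by (cases rule: centred_cases) auto
  qed
  have nh: "AE x in I01. centred (x - z) \<noteq> -1/2"
    using AE_I01_neq[of "z + 1/2"] AE_I01_neq[of "z - 1/2"] AE_space
  proof eventually_elim
    case (elim x)
    then have "\<bar>x - z\<bar> \<le> 1" using z01 by auto
    then show ?case using elim z01 by (cases rule: centred_cases) auto
  qed
  note z
  also have "(\<integral>\<^sup>+x. \<integral>\<^sup>+y. ennreal (indicator (arc z x) y * (2 * \<bar>u x\<bar> * \<bar>v y\<bar>)) \<partial>I01 \<partial>I01)
      \<le> (\<integral>\<^sup>+x. \<integral>\<^sup>+y. ennreal (P x y) + ennreal (Q x y) \<partial>I01 \<partial>I01)"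
  proof (rule nn_integral_mono_AE, use nz nh in eventually_elim, rule nn_integral_mono)
    fix x y assume x: "centred (x - z) \<noteq> 0" "centred (x - z) \<noteq> -1/2"
    show "ennreal (indicator (arc z x) y * (2 * \<bar>u x\<bar> * \<bar>v y\<bar>)) \<le> ennreal (P x y) + ennreal (Q x y)"
    proof (cases "y \<in> arc z x")
      case True
      have xb: "0 < \<bar>centred (x - z)\<bar>" "\<bar>centred (x - z)\<bar> < 1/2"
        using x centred_bounds[of "x - z"] by auto
      then have "\<bar>centred (y - z)\<bar> < 1/2" using True by (auto simp: arc_def)
      then have c: "C y > 0" unfolding C_def by (rule cos_pi_pos)
      have s: "S x > 0" unfolding S_def using xb by (intro sin_gt_zero) auto
      have "indicator (arc z x) y * (2 * \<bar>u x\<bar> * \<bar>v y\<bar>) \<le> P x y + Q x y"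
        using weighted_am_gm[OF c s, of "\<bar>u x\<bar>" "\<bar>v y\<bar>"] True by (simp add: P_def Q_def)
      moreover have "P x y \<ge> 0" "Q x y \<ge> 0" using c s True by (auto simp: P_def Q_def)
      ultimately show ?thesis by (simp add: ennreal_plus[symmetric] ennreal_leI del: ennreal_plus)
    qed auto
  qed
  also have "\<dots> = (\<integral>\<^sup>+x. (\<integral>\<^sup>+y. ennreal (P x y) \<partial>I01) + (\<integral>\<^sup>+y. ennreal (Q x y) \<partial>I01) \<partial>I01)"
    by (intro nn_integral_cong nn_integral_add Pm Qm)
  also have "\<dots> = (\<integral>\<^sup>+x. \<integral>\<^sup>+y. ennreal (P x y) \<partial>I01 \<partial>I01) + (\<integral>\<^sup>+x. \<integral>\<^sup>+y. ennreal (Q x y) \<partial>I01 \<partial>I01)"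
    by (rule nn_integral_add) measurable
  also have "(\<integral>\<^sup>+x. \<integral>\<^sup>+y. ennreal (Q x y) \<partial>I01 \<partial>I01) = (\<integral>\<^sup>+y. \<integral>\<^sup>+x. ennreal (Q x y) \<partial>I01 \<partial>I01)"
    by (rule I01_pair.Fubini'[symmetric]) measurable
  also have "(\<integral>\<^sup>+x. \<integral>\<^sup>+y. ennreal (P x y) \<partial>I01 \<partial>I01) \<le> (\<integral>\<^sup>+x. ennreal ((u x)\<^sup>2 / pi) \<partial>I01)"
  proof (rule nn_integral_mono_AE, use nz in eventually_elim)
    fix x assume x: "centred (x - z) \<noteq> 0"
    have s: "S x > 0" unfolding S_def
      using x centred_bounds[of "x - z"] by (intro sin_gt_zero) auto
    have "(\<integral>\<^sup>+y. ennreal (P x y) \<partial>I01)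
        = (\<integral>\<^sup>+y. ennreal ((u x)\<^sup>2 / S x) * ennreal (indicator (arc z x) y * C y) \<partial>I01)"
      unfolding P_def using s
      by (intro nn_integral_cong, subst ennreal_mult'[symmetric]) (auto simp: field_simps)
    also have "\<dots> = ennreal ((u x)\<^sup>2 / S x) * ennreal (S x / pi)"
      unfolding C_def S_def nn_integral_cos_arc[OF refl, symmetric]
      by (rule nn_integral_cmult) measurable
    also have "\<dots> = ennreal ((u x)\<^sup>2 / pi)"
      using s by (simp add: ennreal_mult'[symmetric])
    finally show "(\<integral>\<^sup>+y. ennreal (P x y) \<partial>I01) \<le> ennreal ((u x)\<^sup>2 / pi)" by simp
  qed
  also have "(\<integral>\<^sup>+y. \<integral>\<^sup>+x. ennreal (Q x y) \<partial>I01 \<partial>I01) \<le> (\<integral>\<^sup>+y. ennreal ((v y)\<^sup>2 / pi) \<partial>I01)"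
  proof (rule nn_integral_mono_AE, use nz nh in eventually_elim)
    fix y assume y: "centred (y - z) \<noteq> 0" "centred (y - z) \<noteq> -1/2"
    have "\<bar>centred (y - z)\<bar> < 1/2" using y centred_bounds[of "y - z"] by auto
    then have c: "C y > 0" unfolding C_def by (rule cos_pi_pos)
    have "(\<integral>\<^sup>+x. ennreal (Q x y) \<partial>I01)
        = (\<integral>\<^sup>+x. ennreal ((v y)\<^sup>2 / C y) * ennreal (indicator (arc z x) y * S x) \<partial>I01)"
      unfolding Q_def using c
      by (intro nn_integral_cong, subst ennreal_mult'[symmetric]) (auto simp: field_simps)
    also have "\<dots> = ennreal ((v y)\<^sup>2 / C y) * (\<integral>\<^sup>+x. ennreal (indicator (arc z x) y * S x) \<partial>I01)"
      by (rule nn_integral_cmult) measurable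
    also have "\<dots> \<le> ennreal ((v y)\<^sup>2 / C y) * ennreal (C y / pi)"
      unfolding C_def S_def using y by (intro mult_left_mono nn_integral_sin_arc refl) auto
    also have "\<dots> = ennreal ((v y)\<^sup>2 / pi)"
      using c by (simp add: ennreal_mult'[symmetric])
    finally show "(\<integral>\<^sup>+x. ennreal (Q x y) \<partial>I01) \<le> ennreal ((v y)\<^sup>2 / pi)" .
  qed
  also have "(\<integral>\<^sup>+x. ennreal ((u x)\<^sup>2 / pi) \<partial>I01) = ennreal (\<integral>x. (u x)\<^sup>2 / pi \<partial>I01)"
    using Bu by (intro nn_integral_eq_integral integrable_I01_bounded[of _ "B\<^sup>2 / pi"])
      (auto intro!: divide_right_mono simp: abs_le_square_iff[symmetric] abs_of_nonneg[OF order_trans[OF abs_ge_zero Bu]])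
  also have "(\<integral>\<^sup>+y. ennreal ((v y)\<^sup>2 / pi) \<partial>I01) = ennreal (\<integral>y. (v y)\<^sup>2 / pi \<partial>I01)"
    using Bv by (intro nn_integral_eq_integral integrable_I01_bounded[of _ "B\<^sup>2 / pi"])
      (auto intro!: divide_right_mono simp: abs_le_square_iff[symmetric] abs_of_nonneg[OF order_trans[OF abs_ge_zero Bv]])
  finally have "ennreal \<bar>kernel_integral I01 I01 order_kernel u v\<bar>
      \<le> ennreal ((\<integral>x. (u x)\<^sup>2 / pi \<partial>I01) + (\<integral>y. (v y)\<^sup>2 / pi \<partial>I01))"
    by (simp add: add_mono)
  then have "\<bar>kernel_integral I01 I01 order_kernel u v\<bar> \<le> (\<integral>x. (u x)\<^sup>2 / pi \<partial>I01) + (\<integral>y. (v y)\<^sup>2 / pi \<partial>I01)"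
    by (subst (asm) ennreal_le_iff) (auto intro!: add_nonneg_nonneg)
  then show ?thesis by (simp add: add_divide_distrib)
qed

section \<open>The bounds for vector-valued maps\<close>

lemma orthonormal_spanning_set:
  fixes B :: "'e::real_inner set"
  assumes "finite B"
  obtains C where "finite C" "span C = span B" "pairwise orthogonal C" "\<And>c. c \<in> C \<Longrightarrow> norm c = 1"
proof -
  obtain D where D: "finite D" "span D = span B" "pairwise orthogonal D"
    using basis_orthogonal[OF assms] by blast
  define C where "C = (\<lambda>d. d /\<^sub>R norm d) ` (D - {0})"
  have "span C = span (D - {0})"
  proof (rule span_eq[THEN iffD2], intro conjI subsetI)
    fix c assume "c \<in> C"
    then obtain d where "d \<in> D - {0}" "c = d /\<^sub>R norm d" by (auto simp: C_def)
    then show "c \<in> span (D - {0})" by (metis span_mul span_base)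
  next
    fix d assume d: "d \<in> D - {0}"
    then have "d = norm d *\<^sub>R (d /\<^sub>R norm d)" by simp
    also have "\<dots> \<in> span C" using d by (intro span_mul span_base) (auto simp: C_def)
    finally show "d \<in> span C" .
  qed
  moreover have "pairwise orthogonal C"
    using D(3) by (auto simp: C_def pairwise_def orthogonal_def)
  ultimately show ?thesis
    using D(1,2) by (intro that[of C]) (auto simp: C_def intro!: left_inverse)
qed

lemma inner_orthonormal_expansion:
  fixes C :: "'e::real_inner set"
  assumes "finite C" "pairwise orthogonal C" "\<And>c. c \<in> C \<Longrightarrow> norm c = 1" "x \<in> span C"
  shows "inner x y = (\<Sum>c\<in>C. inner x c * inner y c)"
  using assms(4)
proof (induction rule: span_induct_alt)
  case base
  then show ?case by simp
next
  case (step a b x)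
  have "(\<Sum>c\<in>C. inner b c * inner y c) = (\<Sum>c\<in>C. if c = b then inner y b else 0)"
  proof (rule sum.cong[OF refl])
    fix c assume "c \<in> C"
    moreover have "inner b b = 1" using assms(3)[OF step(1)] by (simp add: norm_eq_1)
    ultimately show "inner b c * inner y c = (if c = b then inner y b else 0)"
      using assms(2) step(1) by (auto simp: pairwise_def orthogonal_def)
  qed
  also have "\<dots> = inner b y" using assms(1) step(1) by (simp add: inner_commute)
  finally have "a * inner b y = (\<Sum>c\<in>C. a * (inner b c * inner y c))"
    by (simp add: sum_distrib_left [symmetric])
  then show ?case using step(2)
    by (simp add: inner_add_left inner_left_distrib algebra_simps sum.distrib)
qed

lemma integrable_kernel:
  fixes g h :: "real \<Rightarrow> 'e::{real_inner, second_countable_topology}"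
  assumes [measurable]: "g \<in> borel_measurable I01" "h \<in> borel_measurable I01"
    and "\<And>x. 0 < x \<Longrightarrow> x < 1 \<Longrightarrow> norm (g x) \<le> R" "\<And>x. 0 < x \<Longrightarrow> x < 1 \<Longrightarrow> norm (h x) \<le> R"
  shows "integrable (I01 \<Otimes>\<^sub>M I01) (\<lambda>(x, y). order_kernel x y * inner (g x) (h y))"
proof (rule integrable_I01_prod_bounded[of _ "R * R"])
  fix x y :: real assume "0 < x" "x < 1" "0 < y" "y < 1"
  then have "norm (g x) \<le> R" "norm (h y) \<le> R" using assms by auto
  then have "norm (g x) * norm (h y) \<le> R * R"
    by (intro mult_mono) (auto intro: order_trans[OF norm_ge_zero])
  then show "\<bar>case (x, y) of (x, y) \<Rightarrow> order_kernel x y * inner (g x) (h y)\<bar> \<le> R * R"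
    using Cauchy_Schwarz_ineq2[of "g x" "h y"] by (simp add: abs_mult)
qed measurable

text \<open>In orthonormal coordinates the inner product and both squared norms are finite sums, so the scalar
  inequality can be summed over the coordinates without loss.\<close>

lemma span_L2_bound:
  fixes g h :: "real \<Rightarrow> 'e::{real_inner, second_countable_topology}"
  assumes g [measurable]: "g \<in> borel_measurable I01" and h [measurable]: "h \<in> borel_measurable I01"
    and Bg: "\<And>x. 0 < x \<Longrightarrow> x < 1 \<Longrightarrow> norm (g x) \<le> R" and Bh: "\<And>x. 0 < x \<Longrightarrow> x < 1 \<Longrightarrow> norm (h x) \<le> R"
    and "finite B" and gB: "\<And>x. 0 < x \<Longrightarrow> x < 1 \<Longrightarrow> g x \<in> span B" and hB: "\<And>x. 0 < x \<Longrightarrow> x < 1 \<Longrightarrow> h x \<in> span B"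
  shows "kernel_integral I01 I01 order_kernel g h \<le> ((\<integral>x. (norm (g x))\<^sup>2 \<partial>I01) + (\<integral>y. (norm (h y))\<^sup>2 \<partial>I01)) / pi"
proof -
  obtain C where C: "finite C" "span C = span B" "pairwise orthogonal C" "\<And>c. c \<in> C \<Longrightarrow> norm c = 1"
    using orthonormal_spanning_set[OF \<open>finite B\<close>] by blast
  have expand: "inner x y = (\<Sum>c\<in>C. inner x c * inner y c)" if "x \<in> span C" for x y
    by (rule inner_orthonormal_expansion[OF C(1,3) C(4) that])
  have coord: "\<bar>inner w c\<bar> \<le> R" if "c \<in> C" "norm w \<le> R" for w c
    using Cauchy_Schwarz_ineq2[of w c] that C(4) by simp
  have kint: "integrable (I01 \<Otimes>\<^sub>M I01) (\<lambda>p. order_kernel (fst p) (snd p) * (inner (g (fst p)) c * inner (h (snd p)) c))"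
    if "c \<in> C" for c
    using integrable_kernel[of "\<lambda>x. inner (g x) c" "\<lambda>x. inner (h x) c" R] coord that Bg Bh
    by (simp add: case_prod_unfold inner_real_def)
  have sq: "(\<Sum>c\<in>C. \<integral>x. (inner (w x) c)\<^sup>2 \<partial>I01) = (\<integral>x. (norm (w x))\<^sup>2 \<partial>I01)"
    if [measurable]: "w \<in> borel_measurable I01" and Bw: "\<And>x. 0 < x \<Longrightarrow> x < 1 \<Longrightarrow> norm (w x) \<le> R"
      and wB: "\<And>x. 0 < x \<Longrightarrow> x < 1 \<Longrightarrow> w x \<in> span B" for w
  proof -
    have "(\<Sum>c\<in>C. \<integral>x. (inner (w x) c)\<^sup>2 \<partial>I01) = (\<integral>x. (\<Sum>c\<in>C. (inner (w x) c)\<^sup>2) \<partial>I01)"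
    proof (rule Bochner_Integration.integral_sum[symmetric])
      fix c assume c: "c \<in> C"
      show "integrable I01 (\<lambda>x. (inner (w x) c)\<^sup>2)"
      proof (rule integrable_I01_bounded[of _ "R\<^sup>2"])
        fix x :: real assume "0 < x" "x < 1"
        from coord[OF c Bw[OF this]] show "\<bar>(inner (w x) c)\<^sup>2\<bar> \<le> R\<^sup>2"
          using power_mono[of "\<bar>inner (w x) c\<bar>" R 2] by simp
      qed measurable
    qed
    also have "\<dots> = (\<integral>x. (norm (w x))\<^sup>2 \<partial>I01)"
    proof (rule Bochner_Integration.integral_cong[OF refl])
      fix x assume "x \<in> space I01"
      then have "w x \<in> span C" using wB C(2) by auto
      from expand[OF this, of "w x"] show "(\<Sum>c\<in>C. (inner (w x) c)\<^sup>2) = (norm (w x))\<^sup>2"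
        by (simp only: power2_norm_eq_inner) (simp only: power2_eq_square)
    qed
    finally show ?thesis .
  qed
  have "kernel_integral I01 I01 order_kernel g h
      = (\<integral>p. (\<Sum>c\<in>C. order_kernel (fst p) (snd p) * (inner (g (fst p)) c * inner (h (snd p)) c)) \<partial>(I01 \<Otimes>\<^sub>M I01))"
    unfolding kernel_integral_def
  proof (rule Bochner_Integration.integral_cong[OF refl])
    fix p assume "p \<in> space (I01 \<Otimes>\<^sub>M I01)"
    then have "g (fst p) \<in> span C" using gB C(2) by auto
    from expand[OF this, of "h (snd p)"]
    show "(case p of (x, y) \<Rightarrow> order_kernel x y * inner (g x) (h y))
        = (\<Sum>c\<in>C. order_kernel (fst p) (snd p) * (inner (g (fst p)) c * inner (h (snd p)) c))"
      by (simp only: case_prod_unfold sum_distrib_left)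
  qed
  also have "\<dots> = (\<Sum>c\<in>C. kernel_integral I01 I01 order_kernel (\<lambda>x. inner (g x) c) (\<lambda>y. inner (h y) c))"
    using kint by (subst Bochner_Integration.integral_sum) (auto simp: kernel_integral_def case_prod_unfold inner_real_def)
  also have "\<dots> \<le> (\<Sum>c\<in>C. ((\<integral>x. (inner (g x) c)\<^sup>2 \<partial>I01) + (\<integral>y. (inner (h y) c)\<^sup>2 \<partial>I01)) / pi)"
  proof (rule sum_mono)
    fix c assume "c \<in> C"
    then show "kernel_integral I01 I01 order_kernel (\<lambda>x. inner (g x) c) (\<lambda>y. inner (h y) c)
        \<le> ((\<integral>x. (inner (g x) c)\<^sup>2 \<partial>I01) + (\<integral>y. (inner (h y) c)\<^sup>2 \<partial>I01)) / pi"
      by (intro order_trans[OF abs_ge_self scalar_L2_bound[of _ _ R]] coord Bg Bh) auto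
  qed
  also have "\<dots> = ((\<integral>x. (norm (g x))\<^sup>2 \<partial>I01) + (\<integral>y. (norm (h y))\<^sup>2 \<partial>I01)) / pi"
  proof -
    have "(\<Sum>c\<in>C. \<integral>x. (inner (g x) c)\<^sup>2 \<partial>I01) = (\<integral>x. (norm (g x))\<^sup>2 \<partial>I01)"
      "(\<Sum>c\<in>C. \<integral>x. (inner (h x) c)\<^sup>2 \<partial>I01) = (\<integral>x. (norm (h x))\<^sup>2 \<partial>I01)"
      by (rule sq; simp add: Bg gB Bh hB)+
    then show ?thesis by (simp only: sum_divide_distrib[symmetric] sum.distrib)
  qed
  finally show ?thesis .
qed

text \<open>Measurable maps into a separable space are pointwise limits of simple functions, whose values span a
  finite-dimensional subspace. The bound for these passes to the limit by dominated convergence,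
  although the approximants need not take values in the unit sphere.\<close>

lemma sphere_bound:
  fixes g h :: "real \<Rightarrow> 'e::{real_inner, second_countable_topology}"
  assumes "g \<in> sphere_maps I01" "h \<in> sphere_maps I01"
  shows "kernel_integral I01 I01 order_kernel g h \<le> 2 / pi"
proof -
  have g [measurable]: "g \<in> borel_measurable I01" and h [measurable]: "h \<in> borel_measurable I01"
    and n: "\<And>x. 0 < x \<Longrightarrow> x < 1 \<Longrightarrow> norm (g x) = 1" "\<And>x. 0 < x \<Longrightarrow> x < 1 \<Longrightarrow> norm (h x) = 1"
    using assms by (auto simp: sphere_maps_def)
  obtain G where G: "\<And>i. simple_function I01 (G i)" "\<And>x. x \<in> space I01 \<Longrightarrow> (\<lambda>i. G i x) \<longlonglongrightarrow> g x"
      "\<And>i x. x \<in> space I01 \<Longrightarrow> dist (G i x) 0 \<le> 2 * dist (g x) 0"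
    using borel_measurable_implies_sequence_metric[OF g, of 0] by blast
  obtain H where H: "\<And>i. simple_function I01 (H i)" "\<And>x. x \<in> space I01 \<Longrightarrow> (\<lambda>i. H i x) \<longlonglongrightarrow> h x"
      "\<And>i x. x \<in> space I01 \<Longrightarrow> dist (H i x) 0 \<le> 2 * dist (h x) 0"
    using borel_measurable_implies_sequence_metric[OF h, of 0] by blast
  have [measurable]: "G i \<in> borel_measurable I01" "H i \<in> borel_measurable I01" for i
    using G(1) H(1) by (auto intro: borel_measurable_simple_function)
  have GH2: "norm (G i x) \<le> 2" "norm (H i x) \<le> 2" if "0 < x" "x < 1" for i x
    using G(3)[of x i] H(3)[of x i] n[of x] that by auto
  have sq_lim: "(\<lambda>i. \<integral>x. (norm (W i x))\<^sup>2 \<partial>I01) \<longlonglongrightarrow> 1"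
    if [measurable]: "\<And>i. W i \<in> borel_measurable I01" and w: "\<And>x. x \<in> space I01 \<Longrightarrow> (\<lambda>i. W i x) \<longlonglongrightarrow> w x"
      and W2: "\<And>i x. 0 < x \<Longrightarrow> x < 1 \<Longrightarrow> norm (W i x) \<le> 2" and w1: "\<And>x. 0 < x \<Longrightarrow> x < 1 \<Longrightarrow> norm (w x) = 1"
    for W :: "nat \<Rightarrow> real \<Rightarrow> 'e" and w
  proof -
    have "(\<lambda>i. \<integral>x. (norm (W i x))\<^sup>2 \<partial>I01) \<longlonglongrightarrow> (\<integral>x. 1 \<partial>I01)"
    proof (rule integral_dominated_convergence[where w = "\<lambda>_. 4"])
      show "AE x in I01. (\<lambda>i. (norm (W i x))\<^sup>2) \<longlonglongrightarrow> 1"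
      proof (rule AE_I2)
        fix x assume x: "x \<in> space I01"
        have "(\<lambda>i. (norm (W i x))\<^sup>2) \<longlonglongrightarrow> (norm (w x))\<^sup>2"
          by (intro tendsto_intros w x)
        then show "(\<lambda>i. (norm (W i x))\<^sup>2) \<longlonglongrightarrow> 1" using x w1 by simp
      qed
      show "AE x in I01. norm ((norm (W i x))\<^sup>2) \<le> 4" for i
        using W2 power_mono[of "norm (W i _)" 2 2] by (intro AE_I2) simp
    qed auto
    then show ?thesis by (simp add: measure_I01)
  qed
  have lim: "(\<lambda>i. kernel_integral I01 I01 order_kernel (G i) (H i)) \<longlonglongrightarrow> kernel_integral I01 I01 order_kernel g h"
    unfolding kernel_integral_def
  proof (rule integral_dominated_convergence[where w = "\<lambda>_. 4"])
    show "AE p in I01 \<Otimes>\<^sub>M I01. (\<lambda>i. case p of (x, y) \<Rightarrow> order_kernel x y * inner (G i x) (H i y))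
        \<longlonglongrightarrow> (case p of (x, y) \<Rightarrow> order_kernel x y * inner (g x) (h y))"
      by (intro AE_I2) (auto intro!: tendsto_intros G(2) H(2))
    fix i
    show "AE p in I01 \<Otimes>\<^sub>M I01. norm (case p of (x, y) \<Rightarrow> order_kernel x y * inner (G i x) (H i y)) \<le> 4"
    proof (intro AE_I2)
      fix p assume "p \<in> space (I01 \<Otimes>\<^sub>M I01)"
      then have "norm (G i (fst p)) * norm (H i (snd p)) \<le> 2 * 2"
        using GH2 by (intro mult_mono) auto
      then show "norm (case p of (x, y) \<Rightarrow> order_kernel x y * inner (G i x) (H i y)) \<le> 4"
        using Cauchy_Schwarz_ineq2[of "G i (fst p)" "H i (snd p)"] by (simp add: abs_mult split_beta)
    qed
  qed auto
  have "(\<lambda>i. ((\<integral>x. (norm (G i x))\<^sup>2 \<partial>I01) + (\<integral>y. (norm (H i y))\<^sup>2 \<partial>I01)) / pi) \<longlonglongrightarrow> (1 + 1) / pi"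
    using GH2 n by (intro tendsto_intros sq_lim[where w = g] sq_lim[where w = h] G(2) H(2)) auto
  moreover have "kernel_integral I01 I01 order_kernel (G i) (H i)
      \<le> ((\<integral>x. (norm (G i x))\<^sup>2 \<partial>I01) + (\<integral>y. (norm (H i y))\<^sup>2 \<partial>I01)) / pi" for i
  proof (rule span_L2_bound)
    show "finite (G i ` space I01 \<union> H i ` space I01)"
      using G(1)[of i] H(1)[of i] by (auto simp: simple_function_def)
  qed (auto intro: span_base GH2)
  ultimately show ?thesis
    using LIMSEQ_le[OF lim] by force
qed

lemma sphere_bound_line:
  fixes g h :: "real \<Rightarrow> 'e::{real_inner, second_countable_topology}"
  assumes "g \<in> sphere_maps I01" "h \<in> sphere_maps I01"
    and e: "norm e = 1" "span {e} = (UNIV :: 'e set)"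
  shows "kernel_integral I01 I01 order_kernel g h \<le> 1 / 2"
proof -
  have [measurable]: "g \<in> borel_measurable I01" "h \<in> borel_measurable I01"
    and n: "\<And>x. 0 < x \<Longrightarrow> x < 1 \<Longrightarrow> norm (g x) = 1" "\<And>x. 0 < x \<Longrightarrow> x < 1 \<Longrightarrow> norm (h x) = 1"
    using assms by (auto simp: sphere_maps_def)
  have "inner x y = inner x e * inner y e" for x y
    using inner_orthonormal_expansion[of "{e}" x y] e by simp
  then have "kernel_integral I01 I01 order_kernel g h = kernel_integral I01 I01 order_kernel (\<lambda>x. inner (g x) e) (\<lambda>y. inner (h y) e)"
    unfolding kernel_integral_def inner_real_def by metis
  also have "\<dots> \<le> 1 / 2"
  proof (intro order_trans[OF abs_ge_self scalar_sup_bound])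
    show "\<bar>inner (g x) e\<bar> \<le> 1" "\<bar>inner (h x) e\<bar> \<le> 1" if "0 < x" "x < 1" for x
      using Cauchy_Schwarz_ineq2[of "g x" e] Cauchy_Schwarz_ineq2[of "h x" e] n[OF that] e by auto
  qed auto
  finally show ?thesis .
qed

section \<open>Antisymmetry and explicit integrals\<close>

text \<open>Exchanging the variables reverses the order kernel off the diagonal, which is a null set.\<close>

lemma kernel_integral_antisym:
  fixes g h :: "real \<Rightarrow> 'e::{real_inner, second_countable_topology}"
  assumes i: "integrable (I01 \<Otimes>\<^sub>M I01) (\<lambda>(x, y). order_kernel x y * inner (g x) (h y))"
    and j: "integrable (I01 \<Otimes>\<^sub>M I01) (\<lambda>(x, y). order_kernel x y * inner (h x) (g y))"
    and [measurable]: "g \<in> borel_measurable I01" "h \<in> borel_measurable I01"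
  shows "kernel_integral I01 I01 order_kernel h g = - kernel_integral I01 I01 order_kernel g h"
proof -
  have "kernel_integral I01 I01 order_kernel h g = (\<integral>y. (\<integral>x. order_kernel x y * inner (h x) (g y) \<partial>I01) \<partial>I01)"
    unfolding kernel_integral_def by (rule I01_pair.integral_snd[OF j, symmetric])
  also have "\<dots> = (\<integral>y. (\<integral>x. - (order_kernel y x * inner (g y) (h x)) \<partial>I01) \<partial>I01)"
  proof (rule Bochner_Integration.integral_cong[OF refl])
    fix y
    show "(\<integral>x. order_kernel x y * inner (h x) (g y) \<partial>I01) = (\<integral>x. - (order_kernel y x * inner (g y) (h x)) \<partial>I01)"
    proof (rule integral_cong_AE)
      show "AE x in I01. order_kernel x y * inner (h x) (g y) = - (order_kernel y x * inner (g y) (h x))"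
        using AE_I01_neq[of y] by eventually_elim (auto simp: order_kernel_def inner_commute)
    qed measurable
  qed
  also have "\<dots> = - kernel_integral I01 I01 order_kernel g h"
    unfolding kernel_integral_def by (simp add: I01_pair.integral_fst[OF i, symmetric])
  finally show ?thesis .
qed

text \<open>For integrands with one change of formula at \<open>m\<close>, as produced by the sign of \<open>order_kernel m\<close>.\<close>

lemma integral_I01_two_pieces:
  fixes f p q P Q :: "real \<Rightarrow> real"
  assumes m: "0 < m" "m < 1"
    and f: "\<And>x. 0 < x \<Longrightarrow> x < 1 \<Longrightarrow> f x = (if x \<le> m then p x else q x)"
    and [measurable]: "p \<in> borel_measurable borel" "q \<in> borel_measurable borel"
    and P: "\<And>x. 0 \<le> x \<Longrightarrow> x \<le> m \<Longrightarrow> (P has_real_derivative p x) (at x)" "\<And>x. 0 \<le> x \<Longrightarrow> x \<le> m \<Longrightarrow> 0 \<le> p x"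
    and Q: "\<And>x. m \<le> x \<Longrightarrow> x \<le> 1 \<Longrightarrow> (Q has_real_derivative q x) (at x)" "\<And>x. m \<le> x \<Longrightarrow> x \<le> 1 \<Longrightarrow> 0 \<le> q x"
  shows "(\<integral>x. f x \<partial>I01) = (P m - P 0) + (Q 1 - Q m)"
proof -
  have "(\<integral>x. f x \<partial>I01) = (\<integral>x. (if x \<le> m then p x else q x) \<partial>I01)"
    using f by (intro Bochner_Integration.integral_cong) auto
  also have "\<dots> = enn2real (\<integral>\<^sup>+x. ennreal (if x \<le> m then p x else q x) \<partial>I01)"
    using P(2) Q(2) by (intro integral_eq_nn_integral AE_I2 I01_borel_measurable) auto
  also have "(\<integral>\<^sup>+x. ennreal (if x \<le> m then p x else q x) \<partial>I01)
      = (\<integral>\<^sup>+x. ennreal (if x \<le> m then p x else q x) * indicator {0<..<1} x \<partial>lborel)"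
    by (simp add: nn_integral_I01 nn_integral_completion)
  also have "\<dots> = (\<integral>\<^sup>+x. ennreal (p x) * indicator {0..m} x + ennreal (q x) * indicator {m..1} x \<partial>lborel)"
    using AE_lborel_singleton[of 0] AE_lborel_singleton[of m] AE_lborel_singleton[of 1] m
    by (intro nn_integral_cong_AE) (auto elim!: eventually_elim2 split: split_indicator)
  also have "\<dots> = (\<integral>\<^sup>+x. ennreal (p x) * indicator {0..m} x \<partial>lborel) + (\<integral>\<^sup>+x. ennreal (q x) * indicator {m..1} x \<partial>lborel)"
    by (rule nn_integral_add) simp_all
  also have "(\<integral>\<^sup>+x. ennreal (p x) * indicator {0..m} x \<partial>lborel) = ennreal (P m - P 0)"
    using m P by (intro nn_integral_FTC_Icc) auto
  also have "(\<integral>\<^sup>+x. ennreal (q x) * indicator {m..1} x \<partial>lborel) = ennreal (Q 1 - Q m)"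
    using m Q by (intro nn_integral_FTC_Icc) auto
  also have "enn2real (ennreal (P m - P 0) + ennreal (Q 1 - Q m)) = (P m - P 0) + (Q 1 - Q m)"
  proof -
    have "P 0 \<le> P m" using m P by (intro DERIV_nonneg_imp_nondecreasing[of 0 m P]) auto
    moreover have "Q m \<le> Q 1" using m Q by (intro DERIV_nonneg_imp_nondecreasing[of m 1 Q]) auto
    ultimately show ?thesis by (simp add: ennreal_plus[symmetric] del: ennreal_plus)
  qed
  finally show ?thesis .
qed

lemma integral_order_sin:
  assumes x: "0 < x" "x < 1"
  shows "(\<integral>y. order_kernel x y * sin (pi * (y - x)) \<partial>I01) = 2 / pi"
proof -
  have "(\<integral>y. order_kernel x y * sin (pi * (y - x)) \<partial>I01)
      = (cos (pi * (x - x)) / pi - cos (pi * (x - 0)) / pi) + (- cos (pi * (1 - x)) / pi - (- cos (pi * (x - x)) / pi))"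
  proof (rule integral_I01_two_pieces[OF x, where p = "\<lambda>y. sin (pi * (x - y))" and q = "\<lambda>y. sin (pi * (y - x))"
        and P = "\<lambda>y. cos (pi * (x - y)) / pi" and Q = "\<lambda>y. - cos (pi * (y - x)) / pi"])
    fix y :: real
    show "order_kernel x y * sin (pi * (y - x)) = (if y \<le> x then sin (pi * (x - y)) else sin (pi * (y - x)))"
      using sin_minus[of "pi * (x - y)"] by (auto simp: order_kernel_def algebra_simps)
    show "((\<lambda>y. cos (pi * (x - y)) / pi) has_real_derivative sin (pi * (x - y))) (at y)"
      "((\<lambda>y. - cos (pi * (y - x)) / pi) has_real_derivative sin (pi * (y - x))) (at y)"
      by (auto intro!: derivative_eq_intros)
    show "0 \<le> sin (pi * (x - y))" if "0 \<le> y" "y \<le> x"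
      using that x by (intro sin_ge_zero) (auto simp: mult_left_le)
    show "0 \<le> sin (pi * (y - x))" if "x \<le> y" "y \<le> 1"
      using that x by (intro sin_ge_zero) (auto simp: mult_left_le)
  qed auto
  also have "cos (pi * (1 - x)) = - cos (pi * x)"
    by (simp add: right_diff_distrib cos_diff)
  finally show ?thesis by (simp add: field_simps)
qed

lemma integral_order:
  assumes x: "0 < x" "x < 1"
  shows "(\<integral>y. order_kernel x y \<partial>I01) = 1 - 2 * x"
proof -
  have "(\<integral>y. order_kernel x y + 1 \<partial>I01) = (0 - 0) + (2 * 1 - 2 * x)"
    by (rule integral_I01_two_pieces[OF x, where p = "\<lambda>y. 0" and q = "\<lambda>y. 2"
        and P = "\<lambda>y. 0" and Q = "\<lambda>y. 2 * y"])
       (auto intro!: derivative_eq_intros simp: order_kernel_def)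
  moreover have "(\<integral>y. order_kernel x y + 1 \<partial>I01) = (\<integral>y. order_kernel x y \<partial>I01) + (\<integral>y. 1 \<partial>I01)"
    by (intro Bochner_Integration.integral_add integrable_I01_bounded[of _ 1]) auto
  ultimately show ?thesis by (simp add: measure_I01)
qed

lemma integral_abs_centre: "(\<integral>x. \<bar>1 - 2 * x\<bar> \<partial>I01) = 1 / 2"
proof -
  have "(\<integral>x. \<bar>1 - 2 * x\<bar> \<partial>I01) = ((1/2 - (1/2)^2) - (0 - 0^2)) + ((1^2 - 1) - ((1/2)^2 - 1/2))"
    by (rule integral_I01_two_pieces[where m = "1/2" and p = "\<lambda>x. 1 - 2 * x" and q = "\<lambda>x. 2 * x - 1"
        and P = "\<lambda>x. x - x^2" and Q = "\<lambda>x. x^2 - x"])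
       (auto intro!: derivative_eq_intros)
  then show ?thesis by (simp add: power2_eq_square)
qed

section \<open>The circle\<close>

lemma rep_to_circle: obtains k :: int where "rep_circle (to_circle x) = x + of_int k"
proof -
  have "x - rep_circle (to_circle x) \<in> \<int>"
    using circle.abs_eq_iff Quotient3_abs_rep[OF Quotient3_circle, of "to_circle x"] by metis
  then obtain m where "x - rep_circle (to_circle x) = of_int m" by (elim Ints_cases)
  then show ?thesis using that[of "- m"] by simp
qed

lemma to_circle_add_of_int: "to_circle (x + of_int k) = to_circle x"
  by (simp add: circle.abs_eq_iff)

lemma circle_dist_to_circle: "circle_dist (to_circle x) (to_circle y) = \<bar>centred (x - y)\<bar>"
proof -
  have "(INF k::int. \<bar>x - y - of_int k\<bar>) = \<bar>x - y - of_int (round (x-y))\<bar>"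
    using round_diff_minimal[of "x-y"] by (intro cInf_eq_minimum) auto
  then show ?thesis by (simp add: circle_dist.abs_eq centred_def round_def)
qed

lemma inj_to_circle: "inj_on to_circle (space (lebesgue_on {0..<1}))"
  using bij_betw_to_circle by (simp add: space_restrict_space bij_betw_def)

lemma sets_circle_lebesgue: "sets circle_lebesgue = {to_circle ` A |A. A \<in> sets (lebesgue_on {0..<1})}"
  unfolding circle_lebesgue_def by (rule sets_embed_measure'[OF inj_to_circle])

lemma measurable_to_circle: "to_circle \<in> measurable lebesgue circle_lebesgue"
proof (rule measurableI)
  fix A assume "A \<in> sets circle_lebesgue"
  then obtain A0 where A0: "A0 \<in> sets (lebesgue_on {0..<1})" "A = to_circle ` A0"
    by (auto simp: sets_circle_lebesgue)
  have "to_circle -` A = (\<Union>k::int. (\<lambda>x. of_int k + x) ` A0)"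
  proof (intro set_eqI iffI)
    fix x assume "x \<in> to_circle -` A"
    then obtain a where a: "a \<in> A0" "to_circle x = to_circle a" using A0 by auto
    then obtain m :: int where "x - a = of_int m" by (auto simp: circle.abs_eq_iff elim: Ints_cases)
    then have "x = of_int m + a" by simp
    then show "x \<in> (\<Union>k::int. (\<lambda>x. of_int k + x) ` A0)" using a by blast
  next
    fix x assume "x \<in> (\<Union>k::int. (\<lambda>x. of_int k + x) ` A0)"
    then obtain a and k :: int where "a \<in> A0" "x = a + of_int k" by (auto simp: add.commute)
    then show "x \<in> to_circle -` A" using A0 by (simp add: to_circle_add_of_int)
  qed
  moreover have "A0 \<in> sets lebesgue" using A0 by (simp add: sets_restrict_space_iff)
  ultimately show "to_circle -` A \<inter> space lebesgue \<in> sets lebesgue"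
    by (auto intro!: sets.countable_UN'' lebesgue_sets_translation)
qed (simp add: space_circle_lebesgue)

text \<open>Every half-open interval of length \<open>1\<close> is a fundamental domain: the preimage of a set of the circle is
  periodic, so its measure in any period is the same.\<close>

lemma circle_lebesgue_eq_distr: "circle_lebesgue = distr (lebesgue_on {a..<a+1}) circle_lebesgue to_circle"
proof -
  have m: "to_circle \<in> measurable (lebesgue_on {b..<b+1}) circle_lebesgue" for b
    by (rule measurable_restrict_space1[OF measurable_to_circle])
  have em: "emeasure (distr (lebesgue_on {b..<b+1}) circle_lebesgue to_circle) A
      = (\<integral>\<^sup>+x. indicator (to_circle -` A) x * indicator {b..<b+1} x \<partial>lebesgue)"
    if A: "A \<in> sets circle_lebesgue" for A b
  proof -
    have [measurable]: "to_circle -` A \<in> sets lebesgue"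
      using measurable_sets[OF measurable_to_circle A] by simp
    have "emeasure (distr (lebesgue_on {b..<b+1}) circle_lebesgue to_circle) A = emeasure lebesgue (to_circle -` A \<inter> {b..<b+1})"
      using A m[of b] by (simp add: emeasure_distr emeasure_restrict_space space_restrict_space)
    also have "\<dots> = (\<integral>\<^sup>+x. indicator (to_circle -` A \<inter> {b..<b+1}) x \<partial>lebesgue)"
      by (rule nn_integral_indicator[symmetric]) auto
    finally show ?thesis by (simp add: indicator_inter_arith)
  qed
  have "circle_lebesgue = distr (lebesgue_on {0..<0+1}) circle_lebesgue to_circle"
    using embed_measure_eq_distr'[OF inj_to_circle] by (simp add: circle_lebesgue_def)
  also have "\<dots> = distr (lebesgue_on {a..<a+1}) circle_lebesgue to_circle"
  proof (rule measure_eqI)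
    fix A assume "A \<in> sets (distr (lebesgue_on {0..<0+1}) circle_lebesgue to_circle)"
    then have A: "A \<in> sets circle_lebesgue" by simp
    have "indicator (to_circle -` A) \<in> borel_measurable lebesgue"
      using measurable_sets[OF measurable_to_circle A] by (intro borel_measurable_indicator) simp
    then show "emeasure (distr (lebesgue_on {0..<0+1}) circle_lebesgue to_circle) A
        = emeasure (distr (lebesgue_on {a..<a+1}) circle_lebesgue to_circle) A"
      unfolding em[OF A]
      using to_circle_add_of_int[of _ 1] by (subst (1 2) nn_integral_period) (auto simp: indicator_def)
  qed simp
  finally show ?thesis .
qed

lemma integral_half_interval:
  fixes \<psi> :: "real \<Rightarrow> real"
  assumes [measurable]: "\<psi> \<in> borel_measurable lebesgue"
  shows "(\<integral>x. indicator {b..<b+1/2} x * \<psi> x \<partial>lebesgue) = (\<integral>t. \<psi> (b + t/2) \<partial>I01) / 2"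
proof -
  have T: "(\<lambda>x. b + 1/2 * x) \<in> measurable lebesgue lebesgue"
    using lebesgue_affine_measurable[of "\<lambda>_. 1/2" b] by simp
  have f: "(\<lambda>x. indicator {b..<b+1/2} x * \<psi> x) \<in> borel_measurable lebesgue"
    by (intro borel_measurable_times borel_measurable_indicator assms) auto
  have "(\<integral>x. indicator {b..<b+1/2} x * \<psi> x \<partial>lebesgue)
     = (\<integral>x. indicator {b..<b+1/2} x * \<psi> x \<partial>density (distr lebesgue lebesgue (\<lambda>x. b + 1/2 * x)) (\<lambda>_. ennreal \<bar>1/2\<bar>))"
    by (subst lebesgue_real_affine[of "1/2" b]) auto
  also have "\<dots> = (\<integral>x. 1/2 * (indicator {b..<b+1/2} x * \<psi> x) \<partial>distr lebesgue lebesgue (\<lambda>x. b + 1/2 * x))"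
    using f by (subst integral_density) auto
  also have "\<dots> = (\<integral>t. indicator {b..<b+1/2} (b + 1/2 * t) * \<psi> (b + 1/2 * t) \<partial>lebesgue) / 2"
    using f by (subst integral_distr[OF T]) auto
  also have "(\<integral>t. indicator {b..<b+1/2} (b + 1/2 * t) * \<psi> (b + 1/2 * t) \<partial>lebesgue)
      = (\<integral>t. indicator {0<..<1} t * \<psi> (b + 1/2 * t) \<partial>lebesgue)"
  proof (rule integral_cong_AE)
    show "AE t in lebesgue. indicator {b..<b+1/2} (b + 1/2 * t) * \<psi> (b + 1/2 * t) = indicator {0<..<1} t * \<psi> (b + 1/2 * t)"
      using AE_lebesgue_neq[of 0] by eventually_elim (auto split: split_indicator)
    show "(\<lambda>t. indicator {b..<b+1/2} (b + 1/2 * t) * \<psi> (b + 1/2 * t)) \<in> borel_measurable lebesgue"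
      by (rule measurable_compose[OF T f])
    show "(\<lambda>t. indicator {0<..<1} t * \<psi> (b + 1/2 * t)) \<in> borel_measurable lebesgue"
      by (intro borel_measurable_times borel_measurable_indicator measurable_compose[OF T assms]) auto
  qed
  also have "\<dots> = (\<integral>t. \<psi> (b + t/2) \<partial>I01)"
    by (subst integral_restrict_space) auto
  finally show ?thesis .
qed

lemma circle_integral_halves:
  fixes \<phi> :: "circle \<Rightarrow> real"
  assumes \<phi> [measurable]: "\<phi> \<in> borel_measurable circle_lebesgue" and B: "\<And>c. \<bar>\<phi> c\<bar> \<le> B"
  shows "(\<integral>c. \<phi> c \<partial>circle_lebesgue)
    = ((\<integral>t. \<phi> (to_circle (a + t/2)) \<partial>I01) + (\<integral>t. \<phi> (to_circle (a + 1/2 + t/2)) \<partial>I01)) / 2"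
proof -
  define \<psi> where "\<psi> x = \<phi> (to_circle x)" for x
  have \<psi>: "\<psi> \<in> borel_measurable lebesgue"
    unfolding \<psi>_def[abs_def] by (rule measurable_compose[OF measurable_to_circle \<phi>])
  have int: "integrable lebesgue (\<lambda>x. indicator {b..<b+1/2} x * \<psi> x)" for b
  proof -
    have "emeasure lebesgue {b..<b+1/2} = ennreal (1/2)" by simp
    also have "\<dots> < \<infinity>" unfolding infinity_ennreal_def by (rule ennreal_less_top)
    finally have "emeasure lebesgue {b..<b+1/2} < \<infinity>" .
    then show ?thesis
      using integrableI_bounded_set_indicator[OF _ \<psi>, of "{b..<b+1/2}" B] B by (auto simp: \<psi>_def)
  qed
  have "(\<integral>c. \<phi> c \<partial>circle_lebesgue) = (\<integral>c. \<phi> c \<partial>distr (lebesgue_on {a..<a+1}) circle_lebesgue to_circle)"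
    by (subst circle_lebesgue_eq_distr[of a]) (rule refl)
  also have "\<dots> = (\<integral>x. \<psi> x \<partial>lebesgue_on {a..<a+1})"
    unfolding \<psi>_def by (rule integral_distr[OF measurable_restrict_space1[OF measurable_to_circle] \<phi>])
  also have "\<dots> = (\<integral>x. indicator {a..<a+1} x * \<psi> x \<partial>lebesgue)"
    by (subst integral_restrict_space) auto
  also have "\<dots> = (\<integral>x. indicator {a..<a+1/2} x * \<psi> x + indicator {a+1/2..<a+1/2+1/2} x * \<psi> x \<partial>lebesgue)"
    by (intro Bochner_Integration.integral_cong refl) (auto split: split_indicator)
  also have "\<dots> = (\<integral>x. indicator {a..<a+1/2} x * \<psi> x \<partial>lebesgue) + (\<integral>x. indicator {a+1/2..<a+1/2+1/2} x * \<psi> x \<partial>lebesgue)"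
    by (rule Bochner_Integration.integral_add[OF int int])
  also have "\<dots> = ((\<integral>t. \<psi> (a + t/2) \<partial>I01) + (\<integral>t. \<psi> (a + 1/2 + t/2) \<partial>I01)) / 2"
    unfolding integral_half_interval[OF \<psi>] by simp
  finally show ?thesis by (simp add: \<psi>_def)
qed

text \<open>In the coordinate given by the inverse of \<open>to_circle\<close> on \<open>[0, 1)\<close>, which is measurable, the kernel is a
  Borel function on the plane.\<close>

lemma circle_kernel_measurable:
  "(\<lambda>p. circle_kernel (fst p) (snd p)) \<in> borel_measurable (circle_lebesgue \<Otimes>\<^sub>M circle_lebesgue)"
proof -
  define r where "r = inv_into {0..<1} to_circle"
  have r: "to_circle (r c) = c" for c
    unfolding r_def using bij_betw_to_circle by (intro f_inv_into_f) (auto simp: bij_betw_def)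
  have [measurable]: "r \<in> borel_measurable circle_lebesgue"
    unfolding circle_lebesgue_def
  proof (rule measurable_embed_measure1)
    have "r (to_circle x) = x" if "x \<in> space (lebesgue_on {0..<1})" for x
      unfolding r_def using that inj_to_circle by (simp add: space_restrict_space inv_into_f_f)
    then show "(\<lambda>x. r (to_circle x)) \<in> borel_measurable (lebesgue_on {0..<1})"
      by (subst measurable_cong[where g = "\<lambda>x. x"]) (auto intro!: measurable_restrict_space1 measurable_completion)
  qed
  have "circle_kernel c d = (if \<bar>centred (r c - r d)\<bar> < 1/4 then 1 else -1)" for c d
    using circle_dist_to_circle[of "r c" "r d"] by (simp add: r circle_kernel_def)
  then show ?thesis by simp
qed

text \<open>Let \<open>x\<close> run over the half circles that start at \<open>0\<close> and \<open>1/2\<close>, and \<open>y\<close> over those that start at \<open>1/4\<close> and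
  \<open>3/4\<close>. The quarter-turn offset makes the boundary \<open>circle_dist x y = 1/4\<close> the diagonal of each of the
  four cells, so that the circle kernel is an order kernel there. In two of the
  cells its arguments are exchanged rather than its sign, because the value on the diagonal is \<open>-1\<close> in all.\<close>

lemma circle_kernel_halves:
  assumes "0 < s" "s < 1" "0 < t" "t < 1"
  shows "circle_kernel (to_circle (s/2)) (to_circle (1/4 + t/2)) = order_kernel t s"
    and "circle_kernel (to_circle (1/2 + s/2)) (to_circle (1/4 + 1/2 + t/2)) = order_kernel t s"
    and "circle_kernel (to_circle (s/2)) (to_circle (1/4 + 1/2 + t/2)) = order_kernel s t"
    and "circle_kernel (to_circle (1/2 + s/2)) (to_circle (1/4 + t/2)) = order_kernel s t"
proof -
  have main: "(\<bar>centred (s/2 - (1/4 + t/2))\<bar> < 1/4) = (t < s)"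
    using assms centred_eq[of "s/2 - (1/4 + t/2)" 0] centred_eq[of "s/2 - (1/4 + t/2)" "-1"]
    by (cases "-1/2 \<le> s/2 - (1/4 + t/2)") (auto simp: abs_if)
  have opp: "(\<bar>centred (1/2 + s/2 - (1/4 + t/2))\<bar> < 1/4) = (s < t)"
    using assms centred_eq[of "1/2 + s/2 - (1/4 + t/2)" 0] centred_eq[of "1/2 + s/2 - (1/4 + t/2)" 1]
    by (cases "1/2 + s/2 - (1/4 + t/2) < 1/2") (auto simp: abs_if)
  have opp': "(\<bar>centred (s/2 - (1/4 + 1/2 + t/2))\<bar> < 1/4) = (s < t)"
    using assms centred_eq[of "s/2 - (1/4 + 1/2 + t/2)" 0] centred_eq[of "s/2 - (1/4 + 1/2 + t/2)" "-1"]
    by (cases "-1/2 \<le> s/2 - (1/4 + 1/2 + t/2)") (auto simp: abs_if)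
  show "circle_kernel (to_circle (s/2)) (to_circle (1/4 + t/2)) = order_kernel t s"
    unfolding circle_kernel_def order_kernel_def circle_dist_to_circle main ..
  show "circle_kernel (to_circle (1/2 + s/2)) (to_circle (1/4 + 1/2 + t/2)) = order_kernel t s"
  proof -
    have "1/2 + s/2 - (1/4 + 1/2 + t/2) = s/2 - (1/4 + t/2)" by simp
    then show ?thesis unfolding circle_kernel_def order_kernel_def circle_dist_to_circle using main by (simp only:)
  qed
  show "circle_kernel (to_circle (s/2)) (to_circle (1/4 + 1/2 + t/2)) = order_kernel s t"
    unfolding circle_kernel_def order_kernel_def circle_dist_to_circle opp' ..
  show "circle_kernel (to_circle (1/2 + s/2)) (to_circle (1/4 + t/2)) = order_kernel s t"
    unfolding circle_kernel_def order_kernel_def circle_dist_to_circle opp ..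
qed

section \<open>From the interval to the circle\<close>

lemma finite_measure_circle: "finite_measure circle_lebesgue"
  by (rule finite_measureI) (simp add: space_circle_lebesgue emeasure_circle_lebesgue)

interpretation circle: finite_measure circle_lebesgue
  by (rule finite_measure_circle)

interpretation circle_pair: pair_sigma_finite circle_lebesgue circle_lebesgue ..

interpretation circle_prod: finite_measure "circle_lebesgue \<Otimes>\<^sub>M circle_lebesgue"
  by (rule finite_measure_pair_measure) (rule finite_measure_circle)+

lemma sphere_maps_I01D:
  assumes "g \<in> sphere_maps I01"
  shows "g \<in> borel_measurable I01" "\<And>x. 0 < x \<Longrightarrow> x < 1 \<Longrightarrow> norm (g x) \<le> 1"
  using assms by (auto simp: sphere_maps_def)

lemma sphere_maps_half_circle:
  assumes "g \<in> sphere_maps circle_lebesgue"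
  shows "(\<lambda>t. g (to_circle (a + t/2))) \<in> sphere_maps I01"
proof -
  have "(\<lambda>t. a + 1/2 * t) \<in> measurable lebesgue lebesgue"
    using lebesgue_affine_measurable[of "\<lambda>_. 1/2" a] by simp
  from measurable_compose[OF measurable_compose[OF this measurable_to_circle], of g borel]
  have "(\<lambda>t. g (to_circle (a + t/2))) \<in> borel_measurable lebesgue"
    using assms by (simp add: sphere_maps_def)
  then show ?thesis
    using assms by (auto simp: sphere_maps_def space_circle_lebesgue intro: measurable_restrict_space1)
qed

text \<open>Cut the circle of \<open>x\<close> at \<open>0\<close> and \<open>1/2\<close> and that of \<open>y\<close> at \<open>1/4\<close> and \<open>3/4\<close>, and stretch each half to the unit
  interval. The two factors \<open>1/2\<close> from stretching turn the sum over the four cells into an average.\<close>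

lemma kernel_integral_circle:
  fixes g h :: "circle \<Rightarrow> 'e::{real_inner, second_countable_topology}"
  assumes g: "g \<in> sphere_maps circle_lebesgue" and h: "h \<in> sphere_maps circle_lebesgue"
  defines "g0 \<equiv> \<lambda>s. g (to_circle (s/2))" and "g1 \<equiv> \<lambda>s. g (to_circle (1/2 + s/2))"
    and "h0 \<equiv> \<lambda>t. h (to_circle (1/4 + t/2))" and "h1 \<equiv> \<lambda>t. h (to_circle (1/4 + 1/2 + t/2))"
  shows "kernel_integral circle_lebesgue circle_lebesgue circle_kernel g h
    = (kernel_integral I01 I01 order_kernel h0 g0 + kernel_integral I01 I01 order_kernel h1 g1
     + kernel_integral I01 I01 order_kernel g0 h1 + kernel_integral I01 I01 order_kernel g1 h0) / 4"
proof -
  have [measurable]: "g \<in> borel_measurable circle_lebesgue" "h \<in> borel_measurable circle_lebesgue"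
    and n: "\<And>c. norm (g c) = 1" "\<And>c. norm (h c) = 1"
    using g h by (auto simp: sphere_maps_def space_circle_lebesgue)
  note [measurable] = circle_kernel_measurable
  define \<Phi> where "\<Phi> = (\<lambda>p. circle_kernel (fst p) (snd p) * inner (g (fst p)) (h (snd p)))"
  have \<Phi>_meas [measurable]: "\<Phi> \<in> borel_measurable (circle_lebesgue \<Otimes>\<^sub>M circle_lebesgue)"
    unfolding \<Phi>_def by measurable
  have \<Phi>1: "\<bar>\<Phi> p\<bar> \<le> 1" for p
    using Cauchy_Schwarz_ineq2[of "g (fst p)" "h (snd p)"] n by (simp add: \<Phi>_def circle_kernel_def)
  have int: "integrable (circle_lebesgue \<Otimes>\<^sub>M circle_lebesgue) \<Phi>"
    using \<Phi>1 by (intro circle_prod.integrable_const_bound[of _ 1]) auto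
  define \<phi> where "\<phi> c = (\<integral>d. \<Phi> (c, d) \<partial>circle_lebesgue)" for c
  have \<phi>_meas: "\<phi> \<in> borel_measurable circle_lebesgue"
    unfolding \<phi>_def by (rule circle.borel_measurable_lebesgue_integral) simp
  have sec: "(\<lambda>d. \<Phi> (c, d)) \<in> borel_measurable circle_lebesgue" for c
    by (rule measurable_compose[OF measurable_Pair1'[of c circle_lebesgue] \<Phi>_meas]) (simp add: space_circle_lebesgue)
  have \<phi>1: "\<bar>\<phi> c\<bar> \<le> 1" for c
  proof -
    have "norm (\<phi> c) \<le> (\<integral>d. (1::real) \<partial>circle_lebesgue)"
      unfolding \<phi>_def
    proof (rule order_trans[OF integral_norm_bound integral_mono])
      show "integrable circle_lebesgue (\<lambda>d. norm (\<Phi> (c, d)))"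
        using \<Phi>1 sec by (intro integrable_norm circle.integrable_const_bound[of _ 1] AE_I2) auto
    qed (use \<Phi>1 in auto)
    then show ?thesis by (simp add: measure_def space_circle_lebesgue emeasure_circle_lebesgue)
  qed
  have g01: "g0 \<in> sphere_maps I01" "g1 \<in> sphere_maps I01" and h01: "h0 \<in> sphere_maps I01" "h1 \<in> sphere_maps I01"
    using sphere_maps_half_circle[OF g, of 0] sphere_maps_half_circle[OF g, of "1/2"]
      sphere_maps_half_circle[OF h, of "1/4"] sphere_maps_half_circle[OF h, of "1/4 + 1/2"]
    by (simp_all add: g0_def g1_def h0_def h1_def)
  have intI: "integrable (I01 \<Otimes>\<^sub>M I01) (\<lambda>(x, y). order_kernel x y * inner (u x) (v y))"
    if "u \<in> sphere_maps I01" "v \<in> sphere_maps I01" for u v :: "real \<Rightarrow> 'e"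
    by (intro integrable_kernel[of _ _ 1] sphere_maps_I01D[OF that(1)] sphere_maps_I01D[OF that(2)])
  have fwd: "(\<integral>s. (\<integral>t. order_kernel s t * inner (u s) (v t) \<partial>I01) \<partial>I01) = kernel_integral I01 I01 order_kernel u v"
    and bwd: "(\<integral>s. (\<integral>t. order_kernel t s * inner (u s) (v t) \<partial>I01) \<partial>I01) = kernel_integral I01 I01 order_kernel v u"
    if "u \<in> sphere_maps I01" "v \<in> sphere_maps I01" for u v :: "real \<Rightarrow> 'e"
    unfolding kernel_integral_def
    using I01_pair.integral_fst[OF intI[OF that]] I01_pair.integral_snd[OF intI[OF that(2,1)]]
    by (simp_all add: inner_commute)
  have mI: "\<phi> (to_circle (a + s/2)) = ((\<integral>t. \<Phi> (to_circle (a + s/2), to_circle (1/4 + t/2)) \<partial>I01)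
      + (\<integral>t. \<Phi> (to_circle (a + s/2), to_circle (1/4 + 1/2 + t/2)) \<partial>I01)) / 2" for a s
    unfolding \<phi>_def by (rule circle_integral_halves[OF sec \<Phi>1])
  have inner_int: "integrable I01 (\<lambda>s. \<integral>t. order_kernel s t * inner (u s) (v t) \<partial>I01)"
    "integrable I01 (\<lambda>s. \<integral>t. order_kernel t s * inner (u s) (v t) \<partial>I01)"
    if "u \<in> sphere_maps I01" "v \<in> sphere_maps I01" for u v :: "real \<Rightarrow> 'e"
    using I01_pair.integrable_fst[OF intI[OF that]] I01_pair.integrable_snd[OF intI[OF that(2,1)]]
    by (simp_all add: inner_commute)
  have "kernel_integral circle_lebesgue circle_lebesgue circle_kernel g h = (\<integral>c. \<phi> c \<partial>circle_lebesgue)"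
    unfolding kernel_integral_def \<phi>_def using circle_pair.integral_fst'[OF int]
    by (simp add: \<Phi>_def case_prod_unfold)
  also have "\<dots> = ((\<integral>s. \<phi> (to_circle (0 + s/2)) \<partial>I01) + (\<integral>s. \<phi> (to_circle (0 + 1/2 + s/2)) \<partial>I01)) / 2"
    by (rule circle_integral_halves[OF \<phi>_meas \<phi>1])
  also have "(\<integral>s. \<phi> (to_circle (0 + s/2)) \<partial>I01)
      = (\<integral>s. ((\<integral>t. order_kernel t s * inner (g0 s) (h0 t) \<partial>I01) + (\<integral>t. order_kernel s t * inner (g0 s) (h1 t) \<partial>I01)) / 2 \<partial>I01)"
    unfolding mI by (intro Bochner_Integration.integral_cong refl arg_cong2[where f = "(+)"] arg_cong2[where f = "(/)"])
      (auto simp: \<Phi>_def g0_def h0_def h1_def circle_kernel_halves circle_kernel_halves[simplified])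
  also have "\<dots> = (kernel_integral I01 I01 order_kernel h0 g0 + kernel_integral I01 I01 order_kernel g0 h1) / 2"
    using g01 h01 by (simp add: Bochner_Integration.integral_add inner_int fwd bwd)
  also have "(\<integral>s. \<phi> (to_circle (0 + 1/2 + s/2)) \<partial>I01)
      = (\<integral>s. ((\<integral>t. order_kernel s t * inner (g1 s) (h0 t) \<partial>I01) + (\<integral>t. order_kernel t s * inner (g1 s) (h1 t) \<partial>I01)) / 2 \<partial>I01)"
    unfolding mI by (intro Bochner_Integration.integral_cong refl arg_cong2[where f = "(+)"] arg_cong2[where f = "(/)"])
      (auto simp: \<Phi>_def g1_def h0_def h1_def circle_kernel_halves circle_kernel_halves[simplified])
  also have "\<dots> = (kernel_integral I01 I01 order_kernel g1 h0 + kernel_integral I01 I01 order_kernel h1 g1) / 2"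
    using g01 h01 by (simp add: Bochner_Integration.integral_add inner_int fwd bwd)
  finally show ?thesis by (simp add: field_simps)
qed

lemma kernel_integral_uminus:
  "kernel_integral M N f (\<lambda>x. - g x) h = - kernel_integral M N f g h"
  "kernel_integral M N f g (\<lambda>y. - h y) = - kernel_integral M N f g h"
  by (simp_all add: kernel_integral_def case_prod_unfold)

text \<open>The four-cell formula transfers an upper bound for the interval to the circle. It also transfers a
  maximizing pair, provided that both maps are antiperiodic: then \<open>G\<close> and \<open>H\<close>, run along the circle at double
  speed, close up, and the two halves of each map differ by a sign. These signs and the antisymmetry of
  the order kernel give each of the four cells the same maximal value.\<close>

lemma max_interval_and_circle:
  fixes G H :: "real \<Rightarrow> 'e::{real_inner, second_countable_topology}"
  assumes bound: "\<And>g h :: real \<Rightarrow> 'e. g \<in> sphere_maps I01 \<Longrightarrow> h \<in> sphere_maps I01 \<Longrightarrow> kernel_integral I01 I01 order_kernel g h \<le> c"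
    and [measurable]: "G \<in> borel_measurable borel" "H \<in> borel_measurable borel"
    and n: "\<And>x. norm (G x) = 1" "\<And>x. norm (H x) = 1"
    and anti: "\<And>x. G (x + 1) = - G x" "\<And>x. H (x + 1) = - H x"
    and c: "kernel_integral I01 I01 order_kernel G H = c"
  shows "is_max_kernel_integral TYPE('e) I01 I01 order_kernel c
    \<and> is_max_kernel_integral TYPE('e) circle_lebesgue circle_lebesgue circle_kernel c"
proof
  have GH: "G \<in> sphere_maps I01" "H \<in> sphere_maps I01"
    using n by (auto simp: sphere_maps_def intro!: I01_borel_measurable)
  then show "is_max_kernel_integral TYPE('e) I01 I01 order_kernel c"
    unfolding is_max_kernel_integral_def using bound c by blast
  have meas: "(\<lambda>x. w (rep_circle x)) \<in> borel_measurable circle_lebesgue \<and> (\<forall>x. w (rep_circle (to_circle x)) = w x)"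
    if [measurable]: "w \<in> borel_measurable borel" and per: "\<And>x. w (x + 1) = w x" for w :: "real \<Rightarrow> 'e"
  proof -
    have eq: "w (rep_circle (to_circle x)) = w x" for x
    proof -
      obtain k where "rep_circle (to_circle x) = x + of_int k" by (rule rep_to_circle)
      then show ?thesis using periodic_add_of_int[of w x k, OF per] by simp
    qed
    have "(\<lambda>x. w (rep_circle x)) \<in> borel_measurable circle_lebesgue"
      unfolding circle_lebesgue_def
      by (rule measurable_embed_measure1) (auto simp: eq intro!: measurable_restrict_space1 measurable_completion)
    with eq show ?thesis by blast
  qed
  \<comment> \<open>The shift by \<open>1/2\<close> makes \<open>G\<close> start at \<open>1/4\<close> on the circle. The choice of representatives does not
    matter, since \<open>G\<close> and \<open>H\<close> have period \<open>2\<close>.\<close>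
  define g where "g x = H (2 * rep_circle x)" for x
  define h where "h x = G (2 * rep_circle x - 1/2)" for x
  have Hp: "H (2 * (x + 1)) = H (2 * x)" for x
  proof -
    have "2 * (x + 1) = (2 * x + 1) + 1" by simp
    then show ?thesis using anti(2)[of "2 * x + 1"] anti(2)[of "2 * x"] by (simp only:) simp
  qed
  have Gp: "G (2 * (x + 1) - 1/2) = G (2 * x - 1/2)" for x
  proof -
    have "2 * (x + 1) - 1/2 = (2 * x - 1/2 + 1) + 1" by simp
    then show ?thesis using anti(1)[of "2 * x - 1/2 + 1"] anti(1)[of "2 * x - 1/2"] by (simp only:) simp
  qed
  have g: "g \<in> borel_measurable circle_lebesgue" "\<And>x. g (to_circle x) = H (2 * x)"
    unfolding g_def[abs_def] using meas[of "\<lambda>x. H (2 * x)", OF _ Hp] by auto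
  have h: "h \<in> borel_measurable circle_lebesgue" "\<And>x. h (to_circle x) = G (2 * x - 1/2)"
    unfolding h_def[abs_def] using meas[of "\<lambda>x. G (2 * x - 1/2)", OF _ Gp] by auto
  have gh: "g \<in> sphere_maps circle_lebesgue" "h \<in> sphere_maps circle_lebesgue"
    using g(1) h(1) n by (auto simp: sphere_maps_def g_def h_def)
  have halves: "g (to_circle (s/2)) = H s" "g (to_circle (1/2 + s/2)) = - H s"
    "h (to_circle (1/4 + s/2)) = G s" "h (to_circle (1/4 + 1/2 + s/2)) = - G s" for s
    using anti(1)[of s] anti(2)[of s] by (simp_all add: g h algebra_simps)
  have "kernel_integral I01 I01 order_kernel H G = - c"
    using sphere_maps_I01D[OF GH(1)] sphere_maps_I01D[OF GH(2)] c
    by (subst kernel_integral_antisym) (auto intro!: integrable_kernel[of _ _ 1])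
  then have "kernel_integral circle_lebesgue circle_lebesgue circle_kernel g h = c"
    unfolding kernel_integral_circle[OF gh] halves kernel_integral_uminus by (simp add: c)
  moreover have "kernel_integral circle_lebesgue circle_lebesgue circle_kernel u v \<le> c"
    if u: "u \<in> sphere_maps circle_lebesgue" and v: "v \<in> sphere_maps circle_lebesgue" for u v :: "circle \<Rightarrow> 'e"
  proof -
    note U = sphere_maps_half_circle[OF u, of 0, simplified] sphere_maps_half_circle[OF u, of "1/2"]
    note V = sphere_maps_half_circle[OF v, of "1/4"] sphere_maps_half_circle[OF v, of "1/4 + 1/2"]
    show ?thesis
      unfolding kernel_integral_circle[OF u v]
      using bound[OF V(1) U(1)] bound[OF V(2) U(2)] bound[OF U(1) V(2)] bound[OF U(2) V(1)] by simp
  qed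
  ultimately show "is_max_kernel_integral TYPE('e) circle_lebesgue circle_lebesgue circle_kernel c"
    unfolding is_max_kernel_integral_def using gh by blast
qed

section \<open>Maximizers\<close>

text \<open>In an orthonormal frame the unit vectors at angles \<open>\<pi> x + \<pi>/2\<close> and \<open>\<pi> y\<close> have inner product
  \<open>sin (\<pi> (y - x))\<close>, whose sign off the diagonal is the order kernel, so every \<open>x\<close> contributes \<open>2/\<pi>\<close>.\<close>

lemma max_plane:
  fixes e1 e2 :: "'e::{real_inner, second_countable_topology}"
  assumes e: "norm e1 = 1" "norm e2 = 1" "inner e1 e2 = 0"
  shows "is_max_kernel_integral TYPE('e) I01 I01 order_kernel (2 / pi)
    \<and> is_max_kernel_integral TYPE('e) circle_lebesgue circle_lebesgue circle_kernel (2 / pi)"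
proof (rule max_interval_and_circle[where G = "\<lambda>x. cos (pi * x) *\<^sub>R e2 - sin (pi * x) *\<^sub>R e1"
      and H = "\<lambda>x. cos (pi * x) *\<^sub>R e1 + sin (pi * x) *\<^sub>R e2"])
  have ee: "inner e1 e1 = 1" "inner e2 e2 = 1" "inner e2 e1 = 0"
    using e by (simp_all add: norm_eq_1 inner_commute)
  have G: "norm (cos (pi * x) *\<^sub>R e2 - sin (pi * x) *\<^sub>R e1) = 1"
    and H: "norm (cos (pi * x) *\<^sub>R e1 + sin (pi * x) *\<^sub>R e2) = 1" for x
    using ee e(3) by (simp_all add: norm_eq_1 inner_diff_left inner_diff_right inner_add_left inner_add_right
      power2_eq_square[symmetric])
  show "norm (cos (pi * x) *\<^sub>R e2 - sin (pi * x) *\<^sub>R e1) = 1"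
    "norm (cos (pi * x) *\<^sub>R e1 + sin (pi * x) *\<^sub>R e2) = 1" for x
    by (rule G H)+
  have "kernel_integral I01 I01 order_kernel (\<lambda>x. cos (pi * x) *\<^sub>R e2 - sin (pi * x) *\<^sub>R e1) (\<lambda>x. cos (pi * x) *\<^sub>R e1 + sin (pi * x) *\<^sub>R e2)
     = (\<integral>x. (\<integral>y. order_kernel x y * inner (cos (pi * x) *\<^sub>R e2 - sin (pi * x) *\<^sub>R e1) (cos (pi * y) *\<^sub>R e1 + sin (pi * y) *\<^sub>R e2) \<partial>I01) \<partial>I01)"
    unfolding kernel_integral_def
    by (rule I01_pair.integral_fst[symmetric], rule integrable_kernel[of _ _ 1]) (auto simp: G H intro!: I01_borel_measurable)
  also have "\<dots> = (\<integral>x. 2 / pi \<partial>I01)"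
  proof (rule Bochner_Integration.integral_cong[OF refl])
    fix x assume "x \<in> space I01"
    have "inner (cos (pi * x) *\<^sub>R e2 - sin (pi * x) *\<^sub>R e1) (cos (pi * y) *\<^sub>R e1 + sin (pi * y) *\<^sub>R e2) = sin (pi * (y - x))" for y
      using ee e(3) by (simp add: inner_diff_left inner_add_right right_diff_distrib sin_diff algebra_simps)
    then show "(\<integral>y. order_kernel x y * inner (cos (pi * x) *\<^sub>R e2 - sin (pi * x) *\<^sub>R e1) (cos (pi * y) *\<^sub>R e1 + sin (pi * y) *\<^sub>R e2) \<partial>I01) = 2 / pi"
      using \<open>x \<in> space I01\<close> integral_order_sin[of x] by simp
  qed
  finally show "kernel_integral I01 I01 order_kernel (\<lambda>x. cos (pi * x) *\<^sub>R e2 - sin (pi * x) *\<^sub>R e1) (\<lambda>x. cos (pi * x) *\<^sub>R e1 + sin (pi * x) *\<^sub>R e2) = 2 / pi"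
    by (simp add: measure_I01)
qed (auto intro: sphere_bound simp: distrib_left)

text \<open>The constant \<open>e\<close> and \<open>e\<close> times the sign of \<open>1/2 - x\<close> attain the maximum on the
  interval. They are written as square waves on the whole line, because \<open>max_interval_and_circle\<close> asks for antiperiodic maps.\<close>

lemma max_line:
  fixes e :: "'e::{real_inner, second_countable_topology}"
  assumes e: "norm e = 1" "span {e} = UNIV"
  shows "is_max_kernel_integral TYPE('e) I01 I01 order_kernel (1 / 2)
    \<and> is_max_kernel_integral TYPE('e) circle_lebesgue circle_lebesgue circle_kernel (1 / 2)"
proof -
  define H where "H x = (if even \<lfloor>x\<rfloor> then e else - e)" for x :: real
  have [measurable]: "H \<in> borel_measurable borel"
    unfolding H_def[abs_def] by measurable
  have n: "norm (H x) = 1" for x using e by (simp add: H_def)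
  have anti: "H (x + 1) = - H x" for x by (simp add: H_def)
  show ?thesis
  proof (rule max_interval_and_circle[where G = "\<lambda>x. H (x + 1/2)" and H = H])
    have "kernel_integral I01 I01 order_kernel (\<lambda>x. H (x + 1/2)) H
        = (\<integral>x. (\<integral>y. order_kernel x y * inner (H (x + 1/2)) (H y) \<partial>I01) \<partial>I01)"
      unfolding kernel_integral_def
      by (rule I01_pair.integral_fst[symmetric], rule integrable_kernel[of _ _ 1]) (auto simp: n intro!: I01_borel_measurable)
    also have "\<dots> = (\<integral>x. \<bar>1 - 2 * x\<bar> \<partial>I01)"
    proof (rule Bochner_Integration.integral_cong[OF refl])
      fix x assume x: "x \<in> space I01"
      have ee: "inner e e = 1" using e by (simp add: norm_eq_1)
      have "inner (H (x + 1/2)) (H y) = (if x < 1/2 then 1 else -1)" if "y \<in> space I01" for y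
      proof -
        have "\<lfloor>y\<rfloor> = 0" using that by (auto simp: floor_eq_iff)
        moreover have "\<lfloor>x + 1/2\<rfloor> = (if x < 1/2 then 0 else 1)" using x by (auto simp: floor_eq_iff)
        ultimately show ?thesis by (simp add: H_def ee)
      qed
      then have "(\<integral>y. order_kernel x y * inner (H (x + 1/2)) (H y) \<partial>I01) = (\<integral>y. order_kernel x y * (if x < 1/2 then 1 else -1) \<partial>I01)"
        by (intro Bochner_Integration.integral_cong refl) simp
      also have "\<dots> = \<bar>1 - 2 * x\<bar>"
        using x integral_order[of x] by auto
      finally show "(\<integral>y. order_kernel x y * inner (H (x + 1/2)) (H y) \<partial>I01) = \<bar>1 - 2 * x\<bar>" .
    qed
    also have "\<dots> = 1 / 2" by (rule integral_abs_centre)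
    finally show "kernel_integral I01 I01 order_kernel (\<lambda>x. H (x + 1/2)) H = 1 / 2" .
    show "H (x + 1 + 1/2) = - H (x + 1/2)" for x
      using anti[of "x + 1/2"] by (simp add: add_ac)
    show "kernel_integral I01 I01 order_kernel g h \<le> 1 / 2"
      if "g \<in> sphere_maps I01" "h \<in> sphere_maps I01" for g h :: "real \<Rightarrow> 'e"
      by (rule sphere_bound_line[OF that e])
  qed (simp_all add: n anti)
qed

lemma orthonormal_pair:
  assumes "\<And>e :: 'e::real_inner. span {e} \<noteq> UNIV"
  obtains e1 e2 :: "'e::real_inner" where "norm e1 = 1" "norm e2 = 1" "inner e1 e2 = 0"
proof -
  obtain a :: 'e where a: "a \<noteq> 0" using assms[of 0] by auto
  define e1 where "e1 = a /\<^sub>R norm a"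
  have e1: "norm e1 = 1" using a by (simp add: e1_def)
  obtain w where w: "w \<notin> span {e1}" using assms[of e1] by auto
  define v where "v = w - inner w e1 *\<^sub>R e1"
  have "v \<noteq> 0"
    using w span_mul[OF span_base[of e1 "{e1}"], of "inner w e1"] by (auto simp: v_def)
  moreover have "inner e1 v = 0"
    using e1 by (simp add: v_def inner_diff_right norm_eq_1 inner_commute)
  ultimately show ?thesis
    using e1 by (intro that[of e1 "v /\<^sub>R norm v"]) auto
qed

theorem theorem1:
  shows "(let c = (if CARD('n::finite) = 1 then 1/2 else 2/pi) in
       is_max_kernel_integral TYPE(real^'n)
         (lebesgue_on {0<..<1}) (lebesgue_on {0<..<1}) order_kernel c \<and>
       is_max_kernel_integral TYPE(real^'n) circle_lebesgue circle_lebesgue circle_kernel c) \<and>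
    (infinite_dimensional TYPE('h::{real_inner, polish_space}) \<longrightarrow>
       is_max_kernel_integral TYPE('h)
         (lebesgue_on {0<..<1}) (lebesgue_on {0<..<1}) order_kernel (2/pi) \<and>
       is_max_kernel_integral TYPE('h) circle_lebesgue circle_lebesgue circle_kernel (2/pi))"
proof (intro conjI impI)
  show "let c = (if CARD('n) = 1 then 1/2 else 2/pi) in
       is_max_kernel_integral TYPE(real^'n) I01 I01 order_kernel c \<and>
       is_max_kernel_integral TYPE(real^'n) circle_lebesgue circle_lebesgue circle_kernel c"
  proof (cases "CARD('n) = 1")
    case True
    then have "card (Basis :: (real^'n) set) = 1" by simp
    then obtain e :: "real^'n" where e: "Basis = {e}" by (rule card_1_singletonE)
    have "norm e = 1" by (rule norm_Basis) (simp add: e)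
    moreover have "span {e} = UNIV" using span_Basis[where 'a = "real^'n"] by (simp add: e)
    ultimately show ?thesis using max_line[of e] by (simp add: True)
  next
    case False
    have "span {e} \<noteq> UNIV" for e :: "real^'n"
    proof
      assume "span {e} = UNIV"
      then have "dim (UNIV :: (real^'n) set) \<le> card {e}"
        by (metis dim_le_card finite.emptyI finite.insertI order_refl)
      then have "CARD('n) \<le> 1" by simp
      with False show False by (simp add: le_Suc_eq)
    qed
    then obtain e1 e2 :: "real^'n" where "norm e1 = 1" "norm e2 = 1" "inner e1 e2 = 0"
      by (rule orthonormal_pair)
    from max_plane[OF this] show ?thesis using False by simp
  qed
next
  assume inf: "infinite_dimensional TYPE('h)"
  have "span {e} \<noteq> UNIV" for e :: 'h
    using inf unfolding infinite_dimensional_def by (metis finite.emptyI finite.insertI)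
  then obtain e1 e2 :: 'h where "norm e1 = 1" "norm e2 = 1" "inner e1 e2 = 0"
    by (rule orthonormal_pair)
  note max = max_plane[OF this]
  show "is_max_kernel_integral TYPE('h) I01 I01 order_kernel (2/pi)" using max by blast
  show "is_max_kernel_integral TYPE('h) circle_lebesgue circle_lebesgue circle_kernel (2/pi)" using max by blast
qed

end
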